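(* Let $\mathbb{D}$ be the unit disc, $\mathbb{T}$ its boundary, and let $b$ be in the closed unit ball of $H^\infty(\mathbb{D})$. (i) Let $\varphi$ be a parabolic automorphism of $\mathbb{D}$ with fixed point $\xi\in\mathbb{T}$. If $H(b)=(z-\xi)H^2\oplus\mathbb{C}$, then the composition operator $C_\varphi f=f\circ\varphi$ is bounded from $H(b)$ to $H(b)$. (ii) Let $\varphi$ be a hyperbolic automorphism of $\mathbb{D}$ with fixed points $\xi_1,\xi_2\in\mathbb{T}$. If $H(b)=(z-\xi_1)(z-\xi_2)H^2\oplus\mathbb{P}_1$, then $C_\varphi f=f\circ\varphi$ is bounded from $H(b)$ to $H(b)$.
   Context: $H^2=H^2(\mathbb{D})$ is the classical Hardy space; $T_\psi f=P_+(\psi f)$ is the Toeplitz operator; $H(b)$ is the range of $(I-T_bT_{\overline b})^{1/2}$ with norm $\|(I-T_bT_{\overline b})^{1/2}f\|_b=\|f\|_2$ for $f\perp\ker(I-T_bT_{\overline b})^{1/2}$. $\mathbb{P}_1$ is the space of polynomials of degree at most $1$. A parabolic automorphism of $\mathbb{D}$ is a non-identity disc automorphism with exactly one fixed point in $\overline{\mathbb{D}}$, lying on $\mathbb{T}$; a hyperbolic automorphism is one with two distinct fixed points, both on $\mathbb{T}$. *)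

theory Defs
  imports "HOL-Complex_Analysis.Complex_Analysis"
begin

abbreviation disc :: "complex set" where "disc \<equiv> ball 0 1"

text \<open>Functions on the disc are represented by functions complex => complex
  normalised to be 0 outside the disc.\<close>
definition disc_restrict :: "(complex \<Rightarrow> complex) \<Rightarrow> complex \<Rightarrow> complex" where
  "disc_restrict g = (\<lambda>z. if z \<in> disc then g z else 0)"

definition h2coeff :: "(complex \<Rightarrow> complex) \<Rightarrow> nat \<Rightarrow> complex" where
  "h2coeff f n = (deriv ^^ n) f 0 / of_nat (fact n)"

definition H2 :: "(complex \<Rightarrow> complex) set" where
  "H2 = {f. f holomorphic_on disc \<and> (\<forall>z. z \<notin> disc \<longrightarrow> f z = 0)
             \<and> summable (\<lambda>n. (norm (h2coeff f n))\<^sup>2)}"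

definition h2inner :: "(complex \<Rightarrow> complex) \<Rightarrow> (complex \<Rightarrow> complex) \<Rightarrow> complex" where
  "h2inner f g = (\<Sum>n. h2coeff f n * cnj (h2coeff g n))"

definition h2norm :: "(complex \<Rightarrow> complex) \<Rightarrow> real" where
  "h2norm f = sqrt (\<Sum>n. (norm (h2coeff f n))\<^sup>2)"

definition from_coeffs :: "(nat \<Rightarrow> complex) \<Rightarrow> complex \<Rightarrow> complex" where
  "from_coeffs c = disc_restrict (\<lambda>z. \<Sum>n. c n * z ^ n)"

definition Hinf_ball :: "(complex \<Rightarrow> complex) set" where
  "Hinf_ball = {b. b holomorphic_on disc \<and> (\<forall>z\<in>disc. norm (b z) \<le> 1)}"

text \<open>For b analytic and bounded, T_b f = P_+(b f) = b f.\<close>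
definition toep :: "(complex \<Rightarrow> complex) \<Rightarrow> (complex \<Rightarrow> complex) \<Rightarrow> complex \<Rightarrow> complex" where
  "toep b f = disc_restrict (\<lambda>z. b z * f z)"

text \<open>T_{conj b} f = P_+(conj b * f): its n-th Fourier coefficient is
  the sum over k of conj(b_k) f_{n+k}.\<close>
definition toep_conj :: "(complex \<Rightarrow> complex) \<Rightarrow> (complex \<Rightarrow> complex) \<Rightarrow> complex \<Rightarrow> complex" where
  "toep_conj b f = from_coeffs (\<lambda>n. \<Sum>k. cnj (h2coeff b k) * h2coeff f (n + k))"

definition defect_op :: "(complex \<Rightarrow> complex) \<Rightarrow> (complex \<Rightarrow> complex) \<Rightarrow> complex \<Rightarrow> complex" where
  "defect_op b f = (\<lambda>z. f z - toep b (toep_conj b f) z)"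

definition is_pos_sqrt_op ::
  "((complex \<Rightarrow> complex) \<Rightarrow> complex \<Rightarrow> complex) \<Rightarrow> ((complex \<Rightarrow> complex) \<Rightarrow> complex \<Rightarrow> complex) \<Rightarrow> bool" where
  "is_pos_sqrt_op A S \<longleftrightarrow>
     (\<forall>f\<in>H2. S f \<in> H2) \<and> (\<forall>f. f \<notin> H2 \<longrightarrow> S f = (\<lambda>_. 0)) \<and>
     (\<forall>f\<in>H2. \<forall>g\<in>H2. S (\<lambda>z. f z + g z) = (\<lambda>z. S f z + S g z)) \<and>
     (\<forall>f\<in>H2. \<forall>c. S (\<lambda>z. c * f z) = (\<lambda>z. c * S f z)) \<and>
     (\<exists>K. \<forall>f\<in>H2. h2norm (S f) \<le> K * h2norm f) \<and>
     (\<forall>f\<in>H2. h2inner (S f) f \<in> \<real> \<and> Re (h2inner (S f) f) \<ge> 0) \<and>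
     (\<forall>f\<in>H2. S (S f) = A f)"

definition pos_sqrt_op ::
  "((complex \<Rightarrow> complex) \<Rightarrow> complex \<Rightarrow> complex) \<Rightarrow> (complex \<Rightarrow> complex) \<Rightarrow> complex \<Rightarrow> complex" where
  "pos_sqrt_op A = (THE S. is_pos_sqrt_op A S)"

definition Hb :: "(complex \<Rightarrow> complex) \<Rightarrow> (complex \<Rightarrow> complex) set" where
  "Hb b = pos_sqrt_op (defect_op b) ` H2"

definition hb_norm :: "(complex \<Rightarrow> complex) \<Rightarrow> (complex \<Rightarrow> complex) \<Rightarrow> real" where
  "hb_norm b g = h2norm (THE f. f \<in> H2 \<and> pos_sqrt_op (defect_op b) f = g \<and>
        (\<forall>k\<in>H2. pos_sqrt_op (defect_op b) k = (\<lambda>_. 0) \<longrightarrow> h2inner f k = 0))"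

definition disc_aut :: "(complex \<Rightarrow> complex) \<Rightarrow> bool" where
  "disc_aut \<phi> \<longleftrightarrow> \<phi> holomorphic_on disc \<and> bij_betw \<phi> disc disc"

text \<open>Fixed points in the closed disc; on the circle they are fixed points of
  the continuous extension of the automorphism.\<close>
definition aut_fixed :: "(complex \<Rightarrow> complex) \<Rightarrow> complex \<Rightarrow> bool" where
  "aut_fixed \<phi> z \<longleftrightarrow> (z \<in> disc \<and> \<phi> z = z) \<or>
      (norm z = 1 \<and> (\<phi> \<longlongrightarrow> z) (at z within disc))"

definition parabolic_aut :: "(complex \<Rightarrow> complex) \<Rightarrow> complex \<Rightarrow> bool" where
  "parabolic_aut \<phi> \<xi> \<longleftrightarrow> disc_aut \<phi> \<and> (\<exists>z\<in>disc. \<phi> z \<noteq> z) \<and>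
      norm \<xi> = 1 \<and> {z. aut_fixed \<phi> z} = {\<xi>}"

definition hyperbolic_aut :: "(complex \<Rightarrow> complex) \<Rightarrow> complex \<Rightarrow> complex \<Rightarrow> bool" where
  "hyperbolic_aut \<phi> \<xi>1 \<xi>2 \<longleftrightarrow> disc_aut \<phi> \<and> \<xi>1 \<noteq> \<xi>2 \<and>
      norm \<xi>1 = 1 \<and> norm \<xi>2 = 1 \<and> {z. aut_fixed \<phi> z} = {\<xi>1, \<xi>2}"

definition comp_op :: "(complex \<Rightarrow> complex) \<Rightarrow> (complex \<Rightarrow> complex) \<Rightarrow> complex \<Rightarrow> complex" where
  "comp_op \<phi> f = disc_restrict (\<lambda>z. f (\<phi> z))"

definition comp_bounded_on_Hb :: "(complex \<Rightarrow> complex) \<Rightarrow> (complex \<Rightarrow> complex) \<Rightarrow> bool" where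
  "comp_bounded_on_Hb b \<phi> \<longleftrightarrow> (\<forall>f\<in>Hb b. comp_op \<phi> f \<in> Hb b) \<and>
      (\<exists>K. \<forall>f\<in>Hb b. hb_norm b (comp_op \<phi> f) \<le> K * hb_norm b f)"

end

theory Submission
  imports Defs
begin

text \<open>
  Write \<open>\<phi> z = l (z - a) / (1 - cnj a z)\<close>. At a boundary fixed point \<open>\<xi>\<close> the quotient
  \<open>(\<phi> z - \<xi>) / (z - \<xi>)\<close> is a multiple of \<open>1 / (1 - cnj a z)\<close>, hence a bounded multiplier, and with
  two fixed points \<open>\<phi> z - z = cnj a (z - \<xi>1) (z - \<xi>2) / (1 - cnj a z)\<close>. As composition with \<open>\<phi>\<close> maps
  \<open>H2\<close> to itself, the prescribed forms of \<open>H(b)\<close> are invariant under composition with \<open>\<phi>\<close>.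
  Boundedness is then automatic: for \<open>f\<close> in \<open>H2\<close> let \<open>T f\<close> be the preimage of \<open>S f \<circ> \<phi>\<close> under
  \<open>S = (I - T_b T_b*)^(1/2)\<close> that is orthogonal to the kernel of \<open>S\<close>. The seminorm \<open>norm (T f)\<close> is
  lower semicontinuous, so it is bounded by Baire's theorem.
\<close>

section \<open>Operators on real Hilbert spaces\<close>

text \<open>The hypotheses describe H(b) only as a set and give no comparison between
  \<open>hb_norm\<close> and the norms of the summands, so boundedness has to come from invariance
  alone. H(b) is never made into a normed space of its own: its elements are replaced by their
  preimages under S, which puts Baire's theorem to work in H2. \<open>pos_sqrt_op\<close> is a
  definite description and says nothing until a positive root of I - X, with X = T_b T_{conj b}, is
  known to exist and to be unique. The binomial series in X gives a root that commutes with
  everything commuting with X; a rival root R commutes with X = I - R^2, hence with the series, and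
  commuting positive roots of the same operator coincide. H2 is handled as a real Hilbert space. The
  complex structure survives as the operators \<open>cscale c\<close>, and imaginary parts of inner
  products are real inner products against \<open>cscale \<i> g\<close>. In the hyperbolic case
  polynomials of degree at most 1 are not preserved: c1 z becomes c1 \<phi>(z), and the excess c1
  (\<phi>(z) - z) must be absorbed by the summand (z - \<xi>1)(z - \<xi>2) H2.\<close>

lemma lsc_seminorm_bounded:
  fixes p :: "'a::banach \<Rightarrow> real"
  assumes add: "\<And>x y. p (x + y) \<le> p x + p y"
    and scale: "\<And>c x. p (c *\<^sub>R x) = \<bar>c\<bar> * p x"
    and cl: "\<And>c. closed {x. p x \<le> c}"
  shows "\<exists>K. \<forall>x. p x \<le> K * norm x"
proof -
  let ?V = "\<lambda>n::nat. {x. p x \<le> real n}"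
  have "\<exists>n. interior (?V n) \<noteq> {}"
  proof (rule ccontr)
    assume "\<not> ?thesis"
    then have "Met_TC.mtopology interior_of \<Union>(range ?V) = {}"
      using complete_UNIV cl by (intro Met_TC.metric_Baire_category_alt) auto
    moreover have "\<Union>(range ?V) = UNIV"
      using real_arch_simple by auto
    ultimately show False
      by (metis UNIV_not_empty euclidean_interior_of interior_UNIV mtopology_is_euclidean)
  qed
  then obtain n a e where e: "e > 0" "ball a e \<subseteq> ?V n"
    by (metis ex_in_conv mem_interior)
  \<comment> \<open>The ball from Baire's theorem is centred at \<open>a\<close>; moving it to 0
    costs \<open>p (- a) = p a\<close>, hence the factor 2.\<close>
  have bd: "p x \<le> 2 * real n" if "norm x < e" for x
  proof -
    have "a + x \<in> ball a e" "a \<in> ball a e"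
      using that e by (auto simp: dist_norm)
    then have "p (a + x) \<le> real n" "p a \<le> real n"
      using e by blast+
    moreover have "p x \<le> p (a + x) + p (- a)"
      using add[of "a + x" "- a"] by simp
    moreover have "p (- a) = p a"
      using scale[of "-1" a] by simp
    ultimately show ?thesis by simp
  qed
  have "p x \<le> (4 * real n / e) * norm x" for x
  proof (cases "x = 0")
    case True
    then show ?thesis using scale[of 0 0] by simp
  next
    case False
    \<comment> \<open>Scales \<open>x\<close> to norm \<open>e / 2\<close>, strictly inside the
      ball; this is where the constant \<open>4 * real n / e\<close> comes from.\<close>
    define c where "c = e / (2 * norm x)"
    have c: "c > 0" using False e by (simp add: c_def)
    have "norm (c *\<^sub>R x) < e"
      using False e by (simp add: c_def)
    then have "c * p x \<le> 2 * real n"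
      using bd[of "c *\<^sub>R x"] scale[of c x] c by simp
    then have "p x \<le> 2 * real n / c"
      using c by (simp add: field_simps)
    also have "\<dots> = (4 * real n / e) * norm x"
      using False e by (simp add: c_def)
    finally show ?thesis .
  qed
  then show ?thesis by blast
qed

text \<open>A minimising sequence for the distance from \<open>x\<close> to \<open>M\<close> is
  Cauchy by the parallelogram law, and its limit is the foot of the perpendicular.\<close>

lemma closed_subspace_projection:
  fixes M :: "'a::{real_inner,banach} set"
  assumes sub: "subspace M" and cl: "closed M"
  obtains m where "m \<in> M" "\<And>y. y \<in> M \<Longrightarrow> inner (x - m) y = 0"
proof -
  define d where "d = (INF y\<in>M. (norm (x - y))\<^sup>2)"
  have bdd: "bdd_below ((\<lambda>y. (norm (x - y))\<^sup>2) ` M)"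
    by (intro bdd_belowI[of _ 0]) auto
  have ne: "M \<noteq> {}" using sub subspace_0 by auto
  have le: "d \<le> (norm (x - y))\<^sup>2" if "y \<in> M" for y
    unfolding d_def by (rule cINF_lower[OF bdd that])
  have "\<exists>y\<in>M. (norm (x - y))\<^sup>2 < d + 1 / real (Suc n)" for n
  proof -
    have "(INF y\<in>M. (norm (x - y))\<^sup>2) < d + 1 / real (Suc n)"
      by (simp add: d_def)
    then show ?thesis
      using cINF_less_iff[OF ne bdd] by blast
  qed
  then obtain y where yM: "\<And>n. y n \<in> M"
    and y: "\<And>n. (norm (x - y n))\<^sup>2 < d + 1 / real (Suc n)"
    by metis
  have para: "(norm (y i - y j))\<^sup>2 \<le> 2 / real (Suc i) + 2 / real (Suc j)" for i j
  proof -
    have mid: "(1/2) *\<^sub>R (y i + y j) \<in> M"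
      using sub yM by (simp add: subspace_add subspace_scale)
    \<comment> \<open>Parallelogram law for \<open>x - y i\<close> and \<open>x - y j\<close>. The
      midpoint lies in \<open>M\<close>, so the subtracted term is at least \<open>4 * d\<close> and
      cancels the main part of the other two.\<close>
    have "(norm (y i - y j))\<^sup>2 = 2 * (norm (x - y i))\<^sup>2 + 2 * (norm (x - y j))\<^sup>2
        - 4 * (norm (x - (1/2) *\<^sub>R (y i + y j)))\<^sup>2"
      by (simp add: power2_norm_eq_inner algebra_simps inner_commute)
    then show ?thesis
      using y[of i] y[of j] le[OF mid] by (simp add: add_divide_distrib del: of_nat_Suc scaleR_add_right)
  qed
  have "Cauchy y"
  proof (rule metric_CauchyI)
    fix e :: real assume e: "e > 0"
    obtain N where N: "1 / real (Suc N) < e\<^sup>2 / 4"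
      using reals_Archimedean[of "e\<^sup>2 / 4"] e by (auto simp: inverse_eq_divide)
    have "dist (y i) (y j) < e" if "i \<ge> N" "j \<ge> N" for i j
    proof -
      have "1 / real (Suc i) \<le> 1 / real (Suc N)" "1 / real (Suc j) \<le> 1 / real (Suc N)"
        using that by (auto simp: field_simps)
      then have "(norm (y i - y j))\<^sup>2 < e\<^sup>2"
        using para[of i j] N by simp
      then show ?thesis
        using e by (simp add: dist_norm power_less_imp_less_base)
    qed
    then show "\<exists>N. \<forall>i\<ge>N. \<forall>j\<ge>N. dist (y i) (y j) < e" by blast
  qed
  then obtain m where lim: "y \<longlonglongrightarrow> m"
    using Cauchy_convergent convergent_def by blast
  have mM: "m \<in> M"
    using cl yM lim closed_sequentially by blast
  have "(\<lambda>n. (norm (x - y n))\<^sup>2) \<longlonglongrightarrow> (norm (x - m))\<^sup>2"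
    by (intro tendsto_intros lim)
  moreover have "(\<lambda>n. d + 1 / real (Suc n)) \<longlonglongrightarrow> d + 0"
    by (intro tendsto_intros LIMSEQ_Suc[OF lim_1_over_n])
  ultimately have dm: "(norm (x - m))\<^sup>2 \<le> d"
    using y by (intro LIMSEQ_le) (auto intro: less_imp_le)
  have "inner (x - m) z = 0" if z: "z \<in> M" for z
  proof (cases "z = 0")
    case False
    \<comment> \<open>The value that minimises the distance from \<open>x\<close> along the line
      through \<open>m\<close> in direction \<open>z\<close>; minimality of \<open>m\<close> then
      leaves no room for a nonzero inner product.\<close>
    define t where "t = inner (x - m) z / (norm z)\<^sup>2"
    have "m + t *\<^sub>R z \<in> M"
      using sub mM z by (simp add: subspace_add subspace_scale)
    then have "(norm (x - m))\<^sup>2 \<le> (norm (x - (m + t *\<^sub>R z)))\<^sup>2"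
      using le dm order_trans by blast
    also have "\<dots> = (norm (x - m))\<^sup>2 - 2 * t * inner (x - m) z + t\<^sup>2 * (norm z)\<^sup>2"
      by (simp add: power2_norm_eq_inner algebra_simps inner_commute power2_eq_square[of t])
    also have "t\<^sup>2 * (norm z)\<^sup>2 = t * inner (x - m) z"
      using False by (simp add: t_def power2_eq_square)
    finally have "t * inner (x - m) z \<le> 0" by simp
    then have "(inner (x - m) z)\<^sup>2 \<le> 0"
      using False by (simp add: t_def power2_eq_square divide_simps mult_le_0_iff split: if_splits)
    then show ?thesis by simp
  qed simp
  with mM that show thesis by blast
qed

section \<open>The binomial square root of I - X for a symmetric contraction X\<close>

text \<open>Coefficients of the binomial series of \<open>sqrt (1 - x)\<close>.\<close>
definition sqrt_coeff :: "nat \<Rightarrow> real" where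
  "sqrt_coeff n = (- 1) ^ n * ((1/2) gchoose n)"

lemma sqrt_coeff_0 [simp]: "sqrt_coeff 0 = 1"
  by (simp add: sqrt_coeff_def)

lemma sqrt_coeff_Suc_rec: "sqrt_coeff (Suc n) = sqrt_coeff n * ((real n - 1/2) / real (Suc n))"
proof -
  have "real (Suc n) * ((1/2) gchoose (Suc n)) = (1/2 - real n) * ((1/2 :: real) gchoose n)"
    using gbinomial_mult_1[of "1/2 :: real" n] by (simp add: algebra_simps)
  then have eq: "((1/2::real) gchoose (Suc n)) = (1/2 - real n) / real (Suc n) * ((1/2) gchoose n)"
    by (simp add: field_simps del: of_nat_Suc)
  show ?thesis
    unfolding sqrt_coeff_def eq by (simp add: field_simps)
qed

text \<open>Only the ratio from index 0 to index 1 is negative; all later ratios are positive, so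
  the sign stays.\<close>

lemma sqrt_coeff_Suc_le_0: "sqrt_coeff (Suc n) \<le> 0"
proof (induction n)
  case 0
  then show ?case by (simp add: sqrt_coeff_Suc_rec)
next
  case (Suc n)
  then show ?case
    by (subst sqrt_coeff_Suc_rec) (auto intro!: mult_nonpos_nonneg divide_nonpos_nonneg)
qed

text \<open>Partial sums correspond to division by 1 - x, so these are the coefficients of (1 -
  x)^(-1/2), which are positive.\<close>

lemma sqrt_coeff_sum: "(\<Sum>k\<le>m. sqrt_coeff k) \<ge> 0"
proof -
  have "(\<Sum>k\<le>m. sqrt_coeff k) = (- 1) ^ m * ((-1/2 :: real) gchoose m)"
    using gbinomial_sum_lower_neg[of "1/2 :: real" m]
    by (simp add: sqrt_coeff_def mult.commute)
  also have "\<dots> = pochhammer (1/2) m / fact m"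
    by (simp add: gbinomial_pochhammer)
  also have "\<dots> \<ge> 0"
    by (simp add: pochhammer_nonneg)
  finally show ?thesis .
qed

text \<open>By the sign pattern this sum is 1 minus a nonnegative partial sum. The exact constant 1
  matters: it makes the root positive, not merely bounded.\<close>

lemma sqrt_coeff_abs_sum: "(\<Sum>k<n. \<bar>sqrt_coeff (Suc k)\<bar>) \<le> 1"
proof -
  have "(\<Sum>k<n. \<bar>sqrt_coeff (Suc k)\<bar>) = - (\<Sum>k<n. sqrt_coeff (Suc k))"
    using sqrt_coeff_Suc_le_0 by (simp add: sum_negf abs_of_nonpos)
  also have "(\<Sum>k<n. sqrt_coeff (Suc k)) = (\<Sum>k\<le>n. sqrt_coeff k) - 1"
    by (subst sum.atMost_shift) simp
  finally show ?thesis using sqrt_coeff_sum[of n] by simp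
qed

lemma summable_sqrt_coeff_Suc: "summable (\<lambda>k. \<bar>sqrt_coeff (Suc k)\<bar>)"
  and suminf_sqrt_coeff_Suc: "(\<Sum>k. \<bar>sqrt_coeff (Suc k)\<bar>) \<le> 1"
proof -
  show s: "summable (\<lambda>k. \<bar>sqrt_coeff (Suc k)\<bar>)"
    by (rule summableI_nonneg_bounded[OF _ sqrt_coeff_abs_sum]) simp
  show "(\<Sum>k. \<bar>sqrt_coeff (Suc k)\<bar>) \<le> 1"
    by (rule suminf_le_const[OF s sqrt_coeff_abs_sum])
qed

lemma summable_abs_sqrt_coeff: "summable (\<lambda>k. \<bar>sqrt_coeff k\<bar>)"
  using summable_sqrt_coeff_Suc summable_Suc_iff by blast

text \<open>The series squares to 1 - x: Vandermonde's identity with 1/2 + 1/2 = 1.\<close>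

lemma sqrt_coeff_convolution:
  "(\<Sum>k\<le>n. sqrt_coeff k * sqrt_coeff (n - k)) = (if n = 0 then 1 else if n = 1 then -1 else 0)"
proof -
  have "(\<Sum>k\<le>n. sqrt_coeff k * sqrt_coeff (n - k)) =
      (- 1) ^ n * (\<Sum>k=0..n. ((1/2) gchoose k) * ((1/2 :: real) gchoose (n - k)))"
    unfolding sum_distrib_left atMost_atLeast0
  proof (rule sum.cong)
    fix k assume "k \<in> {0..n}"
    then have "(-1::real) ^ n = (-1) ^ k * (-1) ^ (n - k)"
      by (simp flip: power_add)
    then show "sqrt_coeff k * sqrt_coeff (n - k) =
        (- 1) ^ n * (((1/2) gchoose k) * ((1/2) gchoose (n - k)))"
      by (simp add: sqrt_coeff_def)
  qed simp
  also have "\<dots> = (- 1) ^ n * (1 gchoose n)"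
    by (simp add: gbinomial_Vandermonde)
  also have "\<dots> = (- 1) ^ n * of_nat (1 choose n)"
    by (metis binomial_gbinomial of_nat_1)
  also have "\<dots> = (if n = 0 then 1 else if n = 1 then -1 else 0)"
    by (auto simp: binomial_eq_0)
  finally show ?thesis .
qed

text \<open>To be instantiated with X = T_b T_{conj b}. Norm at most 1 suffices because the binomial
  coefficients are absolutely summable up to the boundary of convergence.\<close>

locale symmetric_contraction =
  fixes X :: "'a::{real_inner,banach} \<Rightarrow> 'a"
  assumes bounded_linear_X: "bounded_linear X"
    and norm_X_le: "norm (X f) \<le> norm f"
    and inner_X: "inner (X f) g = inner f (X g)"
begin

definition defect_root :: "'a \<Rightarrow> 'a" where
  "defect_root f = (\<Sum>n. sqrt_coeff n *\<^sub>R (X ^^ n) f)"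

lemma norm_pow_le: "norm ((X ^^ n) f) \<le> norm f"
proof (induction n)
  case (Suc n)
  then show ?case using norm_X_le[of "(X ^^ n) f"] by simp
qed simp

lemma bounded_linear_pow: "bounded_linear (X ^^ n)"
proof (induction n)
  case 0
  then show ?case by (simp add: bounded_linear_ident id_def)
next
  case (Suc n)
  then show ?case
    using bounded_linear_compose[OF bounded_linear_X Suc] by (simp add: comp_def)
qed

lemma inner_pow: "inner ((X ^^ n) f) g = inner f ((X ^^ n) g)"
  by (induction n arbitrary: f g) (simp_all add: inner_X funpow_swap1)

lemma summable_norm_terms: "summable (\<lambda>n. norm (sqrt_coeff n *\<^sub>R (X ^^ n) f))"
proof (rule summable_comparison_test)
  show "\<exists>N. \<forall>n\<ge>N. norm (norm (sqrt_coeff n *\<^sub>R (X ^^ n) f)) \<le> \<bar>sqrt_coeff n\<bar> * norm f"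
    by (auto intro!: mult_left_mono norm_pow_le)
  show "summable (\<lambda>n. \<bar>sqrt_coeff n\<bar> * norm f)"
    by (rule summable_mult2[OF summable_abs_sqrt_coeff])
qed

lemma sums_defect_root: "(\<lambda>n. sqrt_coeff n *\<^sub>R (X ^^ n) f) sums defect_root f"
  unfolding defect_root_def
  by (rule summable_sums[OF summable_norm_cancel[OF summable_norm_terms]])

lemma norm_defect_root_le: "norm (defect_root f) \<le> (\<Sum>n. \<bar>sqrt_coeff n\<bar>) * norm f"
proof -
  have "norm (defect_root f) \<le> (\<Sum>n. norm (sqrt_coeff n *\<^sub>R (X ^^ n) f))"
    unfolding defect_root_def by (rule summable_norm[OF summable_norm_terms])
  also have "\<dots> \<le> (\<Sum>n. \<bar>sqrt_coeff n\<bar> * norm f)"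
    by (intro suminf_le summable_norm_terms summable_mult2[OF summable_abs_sqrt_coeff])
       (auto intro!: mult_left_mono norm_pow_le)
  also have "\<dots> = (\<Sum>n. \<bar>sqrt_coeff n\<bar>) * norm f"
    by (rule suminf_mult2[OF summable_abs_sqrt_coeff, symmetric])
  finally show ?thesis .
qed

lemma bounded_linear_defect_root: "bounded_linear defect_root"
proof (rule bounded_linear_intro)
  note lin = bounded_linear.linear[OF bounded_linear_pow]
  show "defect_root (f + g) = defect_root f + defect_root g" for f g
  proof (rule sums_unique2[OF sums_defect_root])
    show "(\<lambda>n. sqrt_coeff n *\<^sub>R (X ^^ n) (f + g)) sums (defect_root f + defect_root g)"
      using sums_add[OF sums_defect_root sums_defect_root, of f g]
      by (simp add: linear_add[OF lin] scaleR_add_right)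
  qed
  show "defect_root (c *\<^sub>R f) = c *\<^sub>R defect_root f" for c f
  proof (rule sums_unique2[OF sums_defect_root])
    show "(\<lambda>n. sqrt_coeff n *\<^sub>R (X ^^ n) (c *\<^sub>R f)) sums (c *\<^sub>R defect_root f)"
      using sums_scaleR_right[OF sums_defect_root, of c f]
      by (simp add: linear_scale[OF lin] mult.commute)
  qed
  show "norm (defect_root f) \<le> norm f * (\<Sum>n. \<bar>sqrt_coeff n\<bar>)" for f
    using norm_defect_root_le[of f] by (simp add: mult.commute)
qed

lemma sums_inner_defect_root:
  "(\<lambda>n. sqrt_coeff n * inner ((X ^^ n) f) g) sums inner (defect_root f) g"
  using bounded_linear.sums[OF bounded_linear_inner_left sums_defect_root, of f g] by simp

lemma inner_defect_root: "inner (defect_root f) g = inner f (defect_root g)"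
proof (rule sums_unique2[OF sums_inner_defect_root])
  show "(\<lambda>n. sqrt_coeff n * inner ((X ^^ n) f) g) sums inner f (defect_root g)"
    using sums_inner_defect_root[of g f]
    by (simp add: inner_pow[of _ f] inner_commute[of f])
qed

text \<open>The term of index 0 contributes \<open>(norm f)\<^sup>2\<close>; the others have total
  modulus at most that, since their coefficients sum to at most 1 in absolute value.\<close>

lemma defect_root_nonneg: "inner (defect_root f) f \<ge> 0"
proof -
  let ?a = "\<lambda>n. sqrt_coeff n * inner ((X ^^ n) f) f"
  let ?b = "\<lambda>n. \<bar>sqrt_coeff (Suc n)\<bar> * (norm f)\<^sup>2"
  have sb: "summable ?b"
    by (rule summable_mult2[OF summable_sqrt_coeff_Suc])
  have sa: "summable (\<lambda>n. ?a (Suc n))"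
    by (rule summable_Suc_iff[THEN iffD2, OF sums_summable[OF sums_inner_defect_root]])
  have le: "- ?a (Suc n) \<le> ?b n" for n
  proof -
    have "\<bar>inner ((X ^^ Suc n) f) f\<bar> \<le> norm ((X ^^ Suc n) f) * norm f"
      by (rule Cauchy_Schwarz_ineq2)
    also have "\<dots> \<le> norm f * norm f"
      by (intro mult_right_mono norm_pow_le) simp
    finally have "\<bar>?a (Suc n)\<bar> \<le> ?b n"
      unfolding abs_mult power2_eq_square by (intro mult_left_mono) auto
    then show ?thesis by linarith
  qed
  have "- (\<Sum>n. ?a (Suc n)) = (\<Sum>n. - ?a (Suc n))"
    by (rule suminf_minus[OF sa, symmetric])
  also have "\<dots> \<le> (\<Sum>n. ?b n)"
    by (rule suminf_le[OF le summable_minus[OF sa] sb])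
  also have "\<dots> = (\<Sum>n. \<bar>sqrt_coeff (Suc n)\<bar>) * (norm f)\<^sup>2"
    by (rule suminf_mult2[OF summable_sqrt_coeff_Suc, symmetric])
  also have "\<dots> \<le> 1 * (norm f)\<^sup>2"
    by (intro mult_right_mono suminf_sqrt_coeff_Suc) simp
  finally have "- (\<Sum>n. ?a (Suc n)) \<le> (norm f)\<^sup>2" by simp
  moreover have "inner (defect_root f) f = (norm f)\<^sup>2 + (\<Sum>n. ?a (Suc n))"
    using suminf_split_head[OF sums_summable[OF sums_inner_defect_root[of f f]]]
      sums_unique[OF sums_inner_defect_root[of f f]]
    by (simp add: power2_norm_eq_inner)
  ultimately show ?thesis by linarith
qed

text \<open>Termwise in the series. Applied to multiplication by complex scalars, and to a rival
  root in the uniqueness proof.\<close>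

lemma defect_root_commute:
  assumes U: "bounded_linear U" and comm: "\<And>f. U (X f) = X (U f)"
  shows "U (defect_root f) = defect_root (U f)"
proof (rule sums_unique2[OF _ sums_defect_root])
  have "U ((X ^^ n) f) = (X ^^ n) (U f)" for n
    by (induction n) (simp_all add: comm)
  then show "(\<lambda>n. sqrt_coeff n *\<^sub>R (X ^^ n) (U f)) sums U (defect_root f)"
    using bounded_linear.sums[OF U sums_defect_root, of f]
    by (simp add: linear_scale[OF bounded_linear.linear[OF U]])
qed

text \<open>Cauchy product: the absolutely summable double family \<open>F\<close> is regrouped
  along diagonals, where the coefficient convolution leaves only the powers 0 and 1 of
  \<open>X\<close>.\<close>

lemma defect_root_defect_root: "defect_root (defect_root f) = f - X f"
proof -
  define F where "F = (\<lambda>(n, m). (sqrt_coeff n * sqrt_coeff m) *\<^sub>R (X ^^ (n + m)) f)"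
  define G where "G = (\<lambda>(n, m). \<bar>sqrt_coeff n\<bar> * \<bar>sqrt_coeff m\<bar>)"
  have abs: "(\<lambda>n. \<bar>sqrt_coeff n\<bar>) summable_on UNIV"
    using summable_abs_sqrt_coeff by (simp add: summable_on_UNIV_nonneg_real_iff)
  have "G summable_on UNIV \<times> UNIV"
  proof (rule summable_on_SigmaI)
    fix n :: nat assume "n \<in> UNIV"
    show "((\<lambda>m. G (n, m)) has_sum (\<bar>sqrt_coeff n\<bar> * (\<Sum>\<^sub>\<infinity>m. \<bar>sqrt_coeff m\<bar>))) UNIV"
      unfolding G_def prod.case by (intro has_sum_cmult_right has_sum_infsum abs)
  next
    show "(\<lambda>n. \<bar>sqrt_coeff n\<bar> * (\<Sum>\<^sub>\<infinity>m. \<bar>sqrt_coeff m\<bar>)) summable_on UNIV"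
      by (intro summable_on_cmult_left abs)
  qed (auto simp: G_def)
  then have "(\<lambda>x. G x * norm f) summable_on UNIV"
    by (intro summable_on_cmult_left) simp
  then have "F abs_summable_on UNIV"
  proof (rule Infinite_Sum.abs_summable_on_comparison_test')
    fix x :: "nat \<times> nat"
    show "norm (F x) \<le> G x * norm f"
      by (cases x) (auto simp: F_def G_def abs_mult intro!: mult_left_mono norm_pow_le)
  qed
  then have F: "F summable_on UNIV \<times> UNIV"
    by (simp add: abs_summable_summable)
  have lin: "linear (X ^^ n)" for n
    by (rule bounded_linear.linear[OF bounded_linear_pow])
  have inf_eq: "(\<Sum>\<^sub>\<infinity>n. sqrt_coeff n *\<^sub>R (X ^^ n) g) = defect_root g" for g
    by (rule infsumI[OF norm_summable_imp_has_sum[OF summable_norm_terms sums_defect_root]])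
  have inner_eq: "(\<Sum>\<^sub>\<infinity>m. F (n, m)) = sqrt_coeff n *\<^sub>R (X ^^ n) (defect_root f)" for n
  proof -
    have "bounded_linear (\<lambda>g. sqrt_coeff n *\<^sub>R (X ^^ n) g)"
      by (rule bounded_linear_compose[OF bounded_linear_scaleR_right bounded_linear_pow])
    from has_sum_bounded_linear[OF this
        norm_summable_imp_has_sum[OF summable_norm_terms sums_defect_root]]
    have "((\<lambda>m. sqrt_coeff n *\<^sub>R (X ^^ n) (sqrt_coeff m *\<^sub>R (X ^^ m) f)) has_sum
        sqrt_coeff n *\<^sub>R (X ^^ n) (defect_root f)) UNIV" .
    then show ?thesis
      by (intro infsumI) (simp add: F_def linear_scale[OF lin] funpow_add)
  qed
  have "defect_root (defect_root f) = (\<Sum>\<^sub>\<infinity>n. \<Sum>\<^sub>\<infinity>m. F (n, m))"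
    by (simp add: inner_eq inf_eq)
  also have "\<dots> = infsum F (UNIV \<times> UNIV)"
    by (rule infsum_Sigma_banach[OF F])
  \<comment> \<open>\<open>k\<close> is the total degree and \<open>i\<close> the outer index; the
    natural subtraction \<open>k - i\<close> is exact because \<open>i \<le> k\<close> on this index
    set.\<close>
  also have bij: "bij_betw (\<lambda>(k, i). (i, k - i)) (SIGMA k:UNIV. {..k}) (UNIV \<times> (UNIV :: nat set))"
    by (rule bij_betwI[where g = "\<lambda>(n, m). (n + m, n)"]) auto
  have "infsum F (UNIV \<times> UNIV) = infsum (\<lambda>x. F (case x of (k, i) \<Rightarrow> (i, k - i))) (SIGMA k:UNIV. {..k})"
    by (rule infsum_reindex_bij_betw[OF bij, symmetric])
  also have "\<dots> = (\<Sum>\<^sub>\<infinity>k. \<Sum>\<^sub>\<infinity>i\<in>{..k}. F (i, k - i))"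
    using infsum_Sigma_banach[of "\<lambda>x. F (case x of (k, i) \<Rightarrow> (i, k - i))" UNIV "\<lambda>k. {..k}"]
      summable_on_reindex_bij_betw[OF bij, of F] F by simp
  also have "\<dots> = (\<Sum>\<^sub>\<infinity>k. (if k = 0 then 1 else if k = 1 then - 1 else 0) *\<^sub>R (X ^^ k) f)"
  proof (rule infsum_cong)
    fix k :: nat
    have "(\<Sum>\<^sub>\<infinity>i\<in>{..k}. F (i, k - i)) = (\<Sum>i\<le>k. (sqrt_coeff i * sqrt_coeff (k - i)) *\<^sub>R (X ^^ k) f)"
      by (auto simp: F_def intro!: sum.cong)
    also have "\<dots> = (if k = 0 then 1 else if k = 1 then - 1 else 0) *\<^sub>R (X ^^ k) f"
      by (simp only: sqrt_coeff_convolution flip: scaleR_sum_left)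
    finally show "(\<Sum>\<^sub>\<infinity>i\<in>{..k}. F (i, k - i)) = (if k = 0 then 1 else if k = 1 then - 1 else 0) *\<^sub>R (X ^^ k) f" .
  qed
  also have "\<dots> = (\<Sum>\<^sub>\<infinity>k\<in>{0, 1}. (if k = 0 then 1 else if k = 1 then - 1 else 0) *\<^sub>R (X ^^ k) f)"
    by (rule infsum_cong_neutral) auto
  also have "\<dots> = f - X f"
    by simp
  finally show ?thesis .
qed

end

section \<open>Uniqueness of positive roots\<close>

lemma symmetric_nonneg_kernel:
  fixes S :: "'a::real_inner \<Rightarrow> 'a"
  assumes S: "linear S" "\<And>f g. inner (S f) g = inner f (S g)" "\<And>f. inner (S f) f \<ge> 0"
    and 0: "inner (S g) g = 0"
  shows "S g = 0"
proof -
  define h where "h = S g"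
  \<comment> \<open>The form vanishes at \<open>g\<close>, so moving along \<open>h = S g\<close>
    leaves a first-order term that would turn the form negative for small negative \<open>t\<close>
    unless \<open>h = 0\<close>.\<close>
  have quad: "0 \<le> 2 * t * (norm h)\<^sup>2 + t\<^sup>2 * inner (S h) h" for t
  proof -
    have "0 \<le> inner (S (g + t *\<^sub>R h)) (g + t *\<^sub>R h)" by (rule S)
    also have "\<dots> = 2 * t * (norm h)\<^sup>2 + t\<^sup>2 * inner (S h) h"
      using 0 S(2)[of h g]
      by (simp add: linear_add[OF S(1)] linear_scale[OF S(1)] inner_simps h_def[symmetric]
          power2_norm_eq_inner power2_eq_square[of t] inner_commute[of g] algebra_simps)
    finally show ?thesis .
  qed
  define q where "q = inner (S h) h"
  have q: "q \<ge> 0" unfolding q_def by (rule S)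
  define n where "n = (norm h)\<^sup>2"
  have "n = 0"
  proof (rule ccontr)
    assume "n \<noteq> 0"
    then have n: "n > 0" by (simp add: n_def)
    \<comment> \<open>Small enough that the linear term wins, since \<open>u * q < n\<close>; the
      summand 1 covers \<open>q = 0\<close>.\<close>
    define u where "u = n / (q + 1)"
    have "u * (q + 1) = n" using q by (simp add: u_def)
    then have u: "u > 0" "u * q + u = n"
      using n q by (simp_all add: u_def distrib_left)
    have "0 \<le> 2 * (- u) * n + (- u)\<^sup>2 * q"
      using quad[of "- u"] by (simp only: n_def q_def)
    also have "\<dots> = u * (u * q - 2 * n)"
      by (simp add: power2_eq_square algebra_simps)
    also have "\<dots> < 0"
      using u n by (intro mult_pos_neg) linarith+
    finally show False by simp
  qed
  then show ?thesis by (simp add: n_def h_def)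
qed

text \<open>With g = (S - R) f, commutation gives (S + R) g = S^2 f - R^2 f = 0. Two nonnegative
  forms adding up to zero at g both vanish there, so S g = R g = 0, and symmetry turns this into g =
  0.\<close>

lemma positive_root_unique:
  fixes S R :: "'a::real_inner \<Rightarrow> 'a"
  assumes S: "linear S" "\<And>f g. inner (S f) g = inner f (S g)" "\<And>f. inner (S f) f \<ge> 0"
    and R: "linear R" "\<And>f g. inner (R f) g = inner f (R g)" "\<And>f. inner (R f) f \<ge> 0"
    and comm: "\<And>f. R (S f) = S (R f)" and sq: "\<And>f. S (S f) = R (R f)"
  shows "R f = S f"
proof -
  define g where "g = S f - R f"
  have "S g + R g = 0"
    by (simp add: g_def linear_diff[OF S(1)] linear_diff[OF R(1)] comm sq)
  then have "inner (S g) g + inner (R g) g = 0"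
    by (metis inner_add_left inner_zero_left)
  then have "inner (S g) g = 0" "inner (R g) g = 0"
    using S(3)[of g] R(3)[of g] by linarith+
  then have "S g = 0" "R g = 0"
    using symmetric_nonneg_kernel[OF S] symmetric_nonneg_kernel[OF R] by blast+
  moreover have "inner g g = inner f (S g) - inner f (R g)"
    by (subst (1) g_def) (simp add: inner_diff_left S(2) R(2))
  ultimately have "inner g g = 0" by simp
  then show ?thesis by (simp add: g_def)
qed

section \<open>Preimages orthogonal to the kernel, and norms on the range\<close>

lemma subspace_closure:
  fixes M :: "'a::real_normed_vector set"
  assumes M: "subspace M"
  shows "subspace (closure M)"
  unfolding subspace_def
proof (intro conjI ballI allI)
  show "0 \<in> closure M"
    using subspace_0[OF M] closure_subset by blast
next
  fix x y assume "x \<in> closure M" "y \<in> closure M"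
  then obtain u v where uv: "\<And>n. u n \<in> M" "u \<longlonglongrightarrow> x" "\<And>n. v n \<in> M" "v \<longlonglongrightarrow> y"
    unfolding closure_sequential by blast
  have "\<forall>n. u n + v n \<in> M" "(\<lambda>n. u n + v n) \<longlonglongrightarrow> x + y"
    using uv by (auto intro: subspace_add[OF M] tendsto_add)
  then show "x + y \<in> closure M"
    unfolding closure_sequential by (intro exI[of _ "\<lambda>n. u n + v n"] conjI)
next
  fix c x assume "x \<in> closure M"
  then obtain u where u: "\<And>n. u n \<in> M" "u \<longlonglongrightarrow> x"
    unfolding closure_sequential by blast
  have "\<forall>n. c *\<^sub>R u n \<in> M" "(\<lambda>n. c *\<^sub>R u n) \<longlonglongrightarrow> c *\<^sub>R x"
    using u by (auto intro: subspace_scale[OF M] tendsto_scaleR)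
  then show "c *\<^sub>R x \<in> closure M"
    unfolding closure_sequential by (intro exI[of _ "\<lambda>n. c *\<^sub>R u n"] conjI)
qed

text \<open>Subtracting the projection onto the kernel yields the preimage whose norm defines the
  norm of H(b).\<close>

lemma kernel_complement_representative:
  fixes S :: "'a::{real_inner,banach} \<Rightarrow> 'b::real_normed_vector"
  assumes S: "bounded_linear S"
  obtains g where "S g = S f" "\<And>k. S k = 0 \<Longrightarrow> inner g k = 0"
proof -
  note lin = bounded_linear.linear[OF S]
  have "subspace {k. S k = 0}"
    by (simp add: subspace_def linear_0[OF lin] linear_add[OF lin] linear_scale[OF lin])
  moreover have "closed {k. S k = 0}"
    by (intro closed_Collect_eq linear_continuous_on S continuous_on_const)
  ultimately obtain m where "m \<in> {k. S k = 0}" "\<And>y. y \<in> {k. S k = 0} \<Longrightarrow> inner (f - m) y = 0"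
    using closed_subspace_projection[of "{k. S k = 0}" f] by metis
  then show thesis
    using that[of "f - m"] by (simp add: linear_diff[OF lin])
qed

lemma kernel_complement_unique:
  fixes S :: "'a::real_inner \<Rightarrow> 'b::real_vector"
  assumes "linear S" "S f = S g"
    and "\<And>k. S k = 0 \<Longrightarrow> inner f k = 0" "\<And>k. S k = 0 \<Longrightarrow> inner g k = 0"
  shows "f = g"
proof -
  have "S (f - g) = 0"
    using assms(1,2) by (simp add: linear_diff)
  then have "inner (f - g) (f - g) = 0"
    using assms(3,4)[of "f - g"] by (simp add: inner_diff_left)
  then show ?thesis by simp
qed

text \<open>The part of \<open>f\<close> orthogonal to the range is killed by the symmetric
  \<open>S\<close>, so \<open>f\<close> is orthogonal to it as well and it must vanish.\<close>

lemma kernel_complement_subset_closure_range: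
  fixes S :: "'a::{real_inner,banach} \<Rightarrow> 'a"
  assumes S: "bounded_linear S" and sym: "\<And>f g. inner (S f) g = inner f (S g)"
    and f: "\<And>k. S k = 0 \<Longrightarrow> inner f k = 0"
  shows "f \<in> closure (range S)"
proof -
  have "subspace (closure (range S))"
    by (intro subspace_closure linear_subspace_image bounded_linear.linear[OF S] subspace_UNIV)
  then obtain m where m: "m \<in> closure (range S)"
    and orth: "\<And>y. y \<in> closure (range S) \<Longrightarrow> inner (f - m) y = 0"
    using closed_subspace_projection[of "closure (range S)" f] closed_closure by metis
  have "inner (S (f - m)) (S (f - m)) = 0"
    unfolding sym[of "f - m"] by (intro orth subsetD[OF closure_subset]) simp
  then have "inner f (f - m) = 0" using f by simp
  moreover have "inner (f - m) m = 0" using orth m by blast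
  ultimately have "inner (f - m) (f - m) = 0"
    by (simp add: inner_diff_left inner_diff_right inner_commute)
  then show ?thesis using m by simp
qed

text \<open>
  Lower semicontinuity of \<open>norm (T f)\<close> holds because, for \<open>v\<close> orthogonal to the kernel of \<open>S\<close>, the
  norm of \<open>v\<close> is the supremum of \<open>inner v (S e)\<close> over all \<open>e\<close> with \<open>norm (S e) \<le> 1\<close>.
\<close>
lemma range_norm_bounded:
  fixes S C :: "'a::{real_inner,banach} \<Rightarrow> 'a"
  assumes S: "bounded_linear S" and sym: "\<And>f g. inner (S f) g = inner f (S g)"
    and C: "bounded_linear C" and inv: "\<And>f. \<exists>g. S g = C (S f)"
  shows "\<exists>K. \<forall>f. \<exists>g. S g = C (S f) \<and> (\<forall>k. S k = 0 \<longrightarrow> inner g k = 0) \<and> norm g \<le> K * norm f"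
proof -
  note linS = bounded_linear.linear[OF S]
  note linC = bounded_linear.linear[OF C]
  have "\<exists>g. S g = C (S f) \<and> (\<forall>k. S k = 0 \<longrightarrow> inner g k = 0)" for f
  proof -
    obtain h where "S h = C (S f)" using inv by blast
    then show ?thesis
      using kernel_complement_representative[OF S, of h] by metis
  qed
  then obtain T where T: "\<And>f. S (T f) = C (S f)" and orth: "\<And>f k. S k = 0 \<Longrightarrow> inner (T f) k = 0"
    by metis
  \<comment> \<open>\<open>T\<close> is only a choice function; uniqueness of the preimage
    orthogonal to the kernel is what makes it linear.\<close>
  have T_add: "T (f + g) = T f + T g" for f g
    by (rule kernel_complement_unique[OF linS])
       (simp_all add: T linear_add[OF linS] linear_add[OF linC] orth inner_add_left)
  have T_scale: "T (c *\<^sub>R f) = c *\<^sub>R T f" for c f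
    by (rule kernel_complement_unique[OF linS])
       (simp_all add: T linear_scale[OF linS] linear_scale[OF linC] orth)
  \<comment> \<open>Nothing is known yet about continuity of \<open>T\<close>. The right-hand side
    mentions only the continuous \<open>C\<close> and \<open>S\<close>, so it exhibits the sublevel
    set as an intersection of closed sets.\<close>
  have le_iff: "norm (T f) \<le> c \<longleftrightarrow> (\<forall>e. inner (C (S f)) e \<le> c * norm (S e))" if "c \<ge> 0" for c f
  proof
    assume c: "norm (T f) \<le> c"
    show "\<forall>e. inner (C (S f)) e \<le> c * norm (S e)"
    proof
      fix e
      have "inner (C (S f)) e = inner (T f) (S e)"
        by (simp add: sym flip: T)
      also have "\<dots> \<le> norm (T f) * norm (S e)"
        by (rule norm_cauchy_schwarz)
      also have "\<dots> \<le> c * norm (S e)"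
        using c by (rule mult_right_mono) simp
      finally show "inner (C (S f)) e \<le> c * norm (S e)" .
    qed
  next
    assume *: "\<forall>e. inner (C (S f)) e \<le> c * norm (S e)"
    \<comment> \<open>The inequality tests \<open>T f\<close> only against vectors
      \<open>S e\<close>; density lets it be tested against \<open>T f\<close> itself.\<close>
    have "T f \<in> closure (range S)"
      by (rule kernel_complement_subset_closure_range[OF S sym orth])
    then obtain y where y: "\<And>n. y n \<in> range S" "y \<longlonglongrightarrow> T f"
      unfolding closure_sequential by blast
    have "inner (T f) (y n) \<le> c * norm (y n)" for n
    proof -
      obtain e where e: "y n = S e" using y(1)[of n] by blast
      have "inner (T f) (S e) = inner (C (S f)) e"
        by (simp add: sym flip: T)
      then show ?thesis using * e by simp
    qed
    moreover have "(\<lambda>n. inner (T f) (y n)) \<longlonglongrightarrow> inner (T f) (T f)"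
      "(\<lambda>n. c * norm (y n)) \<longlonglongrightarrow> c * norm (T f)"
      by (intro tendsto_intros y)+
    ultimately have "inner (T f) (T f) \<le> c * norm (T f)"
      by (intro LIMSEQ_le) auto
    then have "norm (T f) * norm (T f) \<le> c * norm (T f)"
      by (simp add: power2_norm_eq_inner[symmetric] power2_eq_square)
    then show "norm (T f) \<le> c"
      using that by (cases "norm (T f) = 0") (auto simp: mult_le_cancel_right)
  qed
  have "closed {f. norm (T f) \<le> c}" for c
  proof (cases "c \<ge> 0")
    case True
    have "closed {f. inner (C (S f)) e \<le> c * norm (S e)}" for e
      by (intro closed_Collect_le continuous_on_const continuous_intros
          linear_continuous_on bounded_linear_compose[OF C S])
    then have "closed (\<Inter>e. {f. inner (C (S f)) e \<le> c * norm (S e)})"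
      by (intro closed_INT) blast
    moreover have "{f. norm (T f) \<le> c} = (\<Inter>e. {f. inner (C (S f)) e \<le> c * norm (S e)})"
      using le_iff[OF True] by auto
    ultimately show ?thesis by simp
  next
    case False
    then have "{f. norm (T f) \<le> c} = {}"
      using norm_ge_zero order_trans by blast
    then show ?thesis by simp
  qed
  then have "\<exists>K. \<forall>f. norm (T f) \<le> K * norm f"
    by (intro lsc_seminorm_bounded) (simp_all add: T_add T_scale norm_triangle_ineq)
  then show ?thesis using T orth by blast
qed

section \<open>The Hardy space as a Hilbert space\<close>

lemma h2coeff_sums:
  assumes "f holomorphic_on disc" "z \<in> disc"
  shows "(\<lambda>n. h2coeff f n * z ^ n) sums f z"
  using holomorphic_power_series[of f 0 1 z] assms by (simp add: h2coeff_def)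

lemma h2coeff_add:
  assumes "f holomorphic_on disc" "g holomorphic_on disc"
  shows "h2coeff (\<lambda>z. f z + g z) n = h2coeff f n + h2coeff g n"
  using higher_deriv_add[OF assms, of 0 n] by (simp add: h2coeff_def add_divide_distrib)

lemma h2coeff_cmult:
  assumes "f holomorphic_on disc"
  shows "h2coeff (\<lambda>z. c * f z) n = c * h2coeff f n"
  using higher_deriv_cmult[OF assms, of 0 n c] by (simp add: h2coeff_def)

lemma disc_holomorphic_eqI:
  assumes "f holomorphic_on disc" "g holomorphic_on disc"
    and "\<And>n. h2coeff f n = h2coeff g n" "z \<in> disc"
  shows "f z = g z"
  using sums_unique2[OF h2coeff_sums[OF assms(1,4), unfolded assms(3)] h2coeff_sums[OF assms(2,4)]] .

lemma disc_restrict_holomorphic_iff [simp]: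
  "disc_restrict f holomorphic_on disc \<longleftrightarrow> f holomorphic_on disc"
  by (rule holomorphic_cong) (auto simp: disc_restrict_def)

text \<open>Bounded coefficients already force radius of convergence at least 1, by comparison with
  a geometric series. This covers square summable sequences and the shifted coefficients of a
  multiplier alike.\<close>

lemma from_coeffs_bounded:
  assumes "\<And>n. norm (c n) \<le> M"
  shows from_coeffs_holomorphic: "from_coeffs c holomorphic_on disc"
    and h2coeff_from_coeffs: "h2coeff (from_coeffs c) n = c n"
proof -
  have rad: "fps_conv_radius (Abs_fps c) \<ge> 1"
    unfolding fps_conv_radius_def
  proof (rule conv_radius_geI_ex')
    fix r :: real assume r: "0 < r" "ereal r < 1"
    have "summable (\<lambda>n. M * r ^ n)"
      using r by (intro summable_mult summable_geometric) auto
    then show "summable (\<lambda>n. fps_nth (Abs_fps c) n * complex_of_real r ^ n)"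
    proof (rule summable_comparison_test[rotated])
      show "\<exists>N. \<forall>n\<ge>N. norm (fps_nth (Abs_fps c) n * complex_of_real r ^ n) \<le> M * r ^ n"
        using r assms by (auto simp: norm_mult norm_power intro!: mult_right_mono)
    qed
  qed
  have eq: "from_coeffs c z = eval_fps (Abs_fps c) z" if "z \<in> disc" for z
    using that by (simp add: from_coeffs_def disc_restrict_def eval_fps_def)
  have "disc \<subseteq> eball 0 (fps_conv_radius (Abs_fps c))"
  proof
    fix z :: complex assume "z \<in> disc"
    then have "ereal (norm z) < 1" by simp
    also note rad
    finally show "z \<in> eball 0 (fps_conv_radius (Abs_fps c))"
      by (simp add: in_eball_iff)
  qed
  then have "eval_fps (Abs_fps c) holomorphic_on disc"
    by (rule holomorphic_on_eval_fps)
  then show "from_coeffs c holomorphic_on disc"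
    by (rule holomorphic_transform) (simp add: eq)
  have "from_coeffs c has_fps_expansion Abs_fps c"
    unfolding has_fps_expansion_def
  proof
    show "fps_conv_radius (Abs_fps c) > 0"
      by (rule less_le_trans[OF _ rad]) simp
    have "\<forall>\<^sub>F z in nhds 0. z \<in> disc"
      by (rule eventually_nhds_in_open) auto
    then show "\<forall>\<^sub>F z in nhds 0. eval_fps (Abs_fps c) z = from_coeffs c z"
      by eventually_elim (simp add: eq)
  qed
  from fps_nth_fps_expansion[OF this, of n]
  show "h2coeff (from_coeffs c) n = c n"
    by (simp add: h2coeff_def)
qed

lemma square_summable_bounded:
  fixes c :: "nat \<Rightarrow> complex"
  assumes "summable (\<lambda>n. (norm (c n))\<^sup>2)"
  obtains M where "\<And>n. norm (c n) \<le> M"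
proof -
  have "Bseq (\<lambda>n. (norm (c n))\<^sup>2)"
    by (rule convergent_imp_Bseq[OF summable_LIMSEQ_zero[OF assms, THEN convergentI]])
  then obtain K where K: "\<And>n. (norm (c n))\<^sup>2 \<le> K"
    by (auto simp: Bseq_def)
  have "norm (c n) \<le> sqrt K" for n
    using K[of n] by (rule real_le_rsqrt)
  with that show thesis by blast
qed

lemma from_coeffs_in_H2:
  assumes "summable (\<lambda>n. (norm (c n))\<^sup>2)"
  shows "from_coeffs c \<in> H2" and "h2coeff (from_coeffs c) = c"
proof -
  obtain M where M: "\<And>n. norm (c n) \<le> M"
    using square_summable_bounded[OF assms] by blast
  show eq: "h2coeff (from_coeffs c) = c"
    using h2coeff_from_coeffs[of c, OF M] by blast
  show "from_coeffs c \<in> H2"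
    using from_coeffs_holomorphic[OF M] assms
    by (simp add: H2_def eq) (simp add: from_coeffs_def disc_restrict_def)
qed

lemma H2_holomorphic: "f \<in> H2 \<Longrightarrow> f holomorphic_on disc"
  by (simp add: H2_def)

lemma norm_add_square_le: "(norm (a + b :: complex))\<^sup>2 \<le> 2 * (norm a)\<^sup>2 + 2 * (norm b)\<^sup>2"
proof -
  have "(norm (a + b))\<^sup>2 \<le> (norm a + norm b)\<^sup>2"
    by (intro power_mono norm_triangle_ineq) simp
  also have "\<dots> \<le> 2 * (norm a)\<^sup>2 + 2 * (norm b)\<^sup>2"
    using sum_squares_bound[of "norm a" "norm b"] by (simp add: power2_sum)
  finally show ?thesis .
qed

lemma H2_add:
  assumes "f \<in> H2" "g \<in> H2"
  shows "(\<lambda>z. f z + g z) \<in> H2"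
proof -
  have "summable (\<lambda>n. 2 * (norm (h2coeff f n))\<^sup>2 + 2 * (norm (h2coeff g n))\<^sup>2)"
    using assms by (intro summable_add summable_mult) (auto simp: H2_def)
  then have "summable (\<lambda>n. (norm (h2coeff f n + h2coeff g n))\<^sup>2)"
    by (rule summable_comparison_test[rotated]) (auto intro!: norm_add_square_le)
  then show ?thesis
    using assms by (auto simp: H2_def h2coeff_add intro!: holomorphic_on_add)
qed

lemma H2_cmult: "f \<in> H2 \<Longrightarrow> (\<lambda>z. c * f z) \<in> H2"
  by (simp add: H2_def h2coeff_cmult norm_mult power_mult_distrib holomorphic_on_mult summable_mult)

lemma H2_zero: "(\<lambda>_. 0) \<in> H2"
proof -
  have "h2coeff (\<lambda>_. 0) n = 0" for n
    using h2coeff_cmult[of "\<lambda>_. 0" 0 n] by simp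
  then show ?thesis by (simp add: H2_def)
qed

text \<open>A type is required for the classes \<open>real_inner\<close> and \<open>banach\<close>,
  through which the operator lemmas apply. Vanishing outside the disc makes equality of elements the
  same as equality on the disc.\<close>

typedef hardy = H2 morphisms hfun Hardy
  using H2_zero by blast

definition hcoeff :: "hardy \<Rightarrow> nat \<Rightarrow> complex" where
  "hcoeff f = h2coeff (hfun f)"

text \<open>The complex structure is kept as a separate operation, because \<open>real_inner\<close>
  knows only real scalars.\<close>

definition cscale :: "complex \<Rightarrow> hardy \<Rightarrow> hardy" where
  "cscale c f = Hardy (\<lambda>z. c * hfun f z)"

lemma hfun_holomorphic [simp]: "hfun f holomorphic_on disc"
  by (rule H2_holomorphic[OF hfun])

lemma hfun_outside: "z \<notin> disc \<Longrightarrow> hfun f z = 0"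
  using hfun[of f] by (simp add: H2_def)

lemma hfun_sums: "z \<in> disc \<Longrightarrow> (\<lambda>n. hcoeff f n * z ^ n) sums hfun f z"
  unfolding hcoeff_def by (rule h2coeff_sums[OF hfun_holomorphic])

lemma summable_hcoeff: "summable (\<lambda>n. (norm (hcoeff f n))\<^sup>2)"
  using hfun[of f] by (simp add: H2_def hcoeff_def)

lemma hardy_eqI:
  assumes "\<And>n. hcoeff f n = hcoeff g n"
  shows "f = g"
proof -
  have "hfun f z = hfun g z" for z
    using disc_holomorphic_eqI[of "hfun f" "hfun g" z] assms hfun_outside[of z]
    by (cases "z \<in> disc") (simp_all add: hcoeff_def)
  then have "hfun f = hfun g" by (rule ext)
  then show ?thesis by (simp add: hfun_inject)
qed

lemma hardy_fun_eqI:
  assumes "\<And>z. z \<in> disc \<Longrightarrow> hfun f z = hfun g z"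
  shows "f = g"
proof -
  have "hfun f z = hfun g z" for z
    using assms[of z] hfun_outside[of z] by (cases "z \<in> disc") auto
  then have "hfun f = hfun g" by (rule ext)
  then show ?thesis by (simp add: hfun_inject)
qed

lemma hardy_of_coeffs:
  assumes "summable (\<lambda>n. (norm (c n))\<^sup>2)"
  obtains f where "hcoeff f = c" "hfun f = from_coeffs c"
  using that[of "Hardy (from_coeffs c)"] from_coeffs_in_H2[OF assms]
  by (simp add: Hardy_inverse hcoeff_def)

lemma hfun_cscale: "hfun (cscale c f) = (\<lambda>z. c * hfun f z)"
  by (simp add: cscale_def Hardy_inverse H2_cmult hfun)

lemma hcoeff_cscale: "hcoeff (cscale c f) n = c * hcoeff f n"
  by (simp add: hcoeff_def hfun_cscale h2coeff_cmult)

lemma norm_mult_cnj_le: "norm (a * cnj b) \<le> (norm a)\<^sup>2 + (norm b)\<^sup>2"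
proof -
  have "2 * (norm a * norm b) \<le> (norm a)\<^sup>2 + (norm b)\<^sup>2" "0 \<le> norm a * norm b"
    using sum_squares_bound[of "norm a" "norm b"] by simp_all
  then show ?thesis unfolding norm_mult complex_mod_cnj by linarith
qed

lemma summable_hcoeff_mult: "summable (\<lambda>n. hcoeff f n * cnj (hcoeff g n))"
proof (rule summable_comparison_test)
  show "\<exists>N. \<forall>n\<ge>N. norm (hcoeff f n * cnj (hcoeff g n)) \<le> (norm (hcoeff f n))\<^sup>2 + (norm (hcoeff g n))\<^sup>2"
    using norm_mult_cnj_le by blast
qed (intro summable_add summable_hcoeff)

instantiation hardy :: real_inner
begin

definition zero_hardy where "0 = Hardy (\<lambda>_. 0)"
definition plus_hardy where "f + g = Hardy (\<lambda>z. hfun f z + hfun g z)"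
definition uminus_hardy where "- f = cscale (- 1) f"
definition minus_hardy where "f - g = f + - (g :: hardy)"
definition scaleR_hardy where "scaleR r = cscale (complex_of_real r)"
text \<open>The real part of the complex inner product, which induces the same norm.\<close>

definition inner_hardy where "inner f g = (\<Sum>n. Re (hcoeff f n * cnj (hcoeff g n)))"
definition norm_hardy where "norm f = sqrt (inner f (f :: hardy))"
definition dist_hardy where "dist f g = norm (f - g :: hardy)"
definition sgn_hardy where "sgn f = inverse (norm f) *\<^sub>R (f :: hardy)"
definition uniformity_hardy :: "(hardy \<times> hardy) filter" where
  "uniformity_hardy = (INF e\<in>{0<..}. principal {(x, y). dist x y < e})"
definition open_hardy :: "hardy set \<Rightarrow> bool" where
  "open_hardy U \<longleftrightarrow> (\<forall>x\<in>U. \<forall>\<^sub>F (x', y) in uniformity. x' = x \<longrightarrow> y \<in> U)"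

lemma hfun_add: "hfun (f + g) = (\<lambda>z. hfun f z + hfun g z)"
  by (simp add: plus_hardy_def Hardy_inverse H2_add hfun)

lemma hfun_zero: "hfun 0 = (\<lambda>_. 0)"
  by (simp add: zero_hardy_def Hardy_inverse H2_zero)

lemma hcoeff_add: "hcoeff (f + g) n = hcoeff f n + hcoeff g n"
  by (simp add: hcoeff_def hfun_add h2coeff_add)

lemma hcoeff_scaleR: "hcoeff (r *\<^sub>R f) n = complex_of_real r * hcoeff f n"
  by (simp add: scaleR_hardy_def hcoeff_cscale)

lemma hcoeff_zero: "hcoeff 0 n = 0"
  using h2coeff_cmult[of "\<lambda>_. 0" 0 n] by (simp add: hcoeff_def hfun_zero)

lemma hcoeff_minus: "hcoeff (- f) n = - hcoeff f n"
  by (simp add: uminus_hardy_def hcoeff_cscale)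

lemma summable_Re_hcoeff_mult: "summable (\<lambda>n. Re (hcoeff f n * cnj (hcoeff g n)))"
  by (rule summable_Re[OF summable_hcoeff_mult])

lemma inner_self_hardy: "inner f f = (\<Sum>n. (norm (hcoeff f n))\<^sup>2)"
  unfolding inner_hardy_def complex_norm_square[symmetric] Re_complex_of_real ..

instance
proof
  fix f g h :: hardy and r s :: real
  show "f + g + h = f + (g + h)" "f + g = g + f" "0 + f = f" "- f + f = 0" "f - g = f + - g"
    "r *\<^sub>R (f + g) = r *\<^sub>R f + r *\<^sub>R g" "(r + s) *\<^sub>R f = r *\<^sub>R f + s *\<^sub>R f"
    "r *\<^sub>R s *\<^sub>R f = (r * s) *\<^sub>R f" "1 *\<^sub>R f = f"
    by (auto intro!: hardy_eqI simp: hcoeff_add hcoeff_zero hcoeff_minus hcoeff_scaleR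
        minus_hardy_def algebra_simps)
  show "dist f g = norm (f - g)" "sgn f = inverse (norm f) *\<^sub>R f" "norm f = sqrt (inner f f)"
    "uniformity = (INF e\<in>{0<..}. principal {(x :: hardy, y). dist x y < e})"
    by (simp_all add: dist_hardy_def sgn_hardy_def norm_hardy_def uniformity_hardy_def)
  show "open U \<longleftrightarrow> (\<forall>x\<in>U. \<forall>\<^sub>F (x', y) in uniformity. x' = x \<longrightarrow> y \<in> U)" for U :: "hardy set"
    by (simp add: open_hardy_def)
  show "inner f g = inner g f"
    by (simp add: inner_hardy_def algebra_simps)
  show "inner (f + g) h = inner f h + inner g h"
    unfolding inner_hardy_def
    by (subst suminf_add[OF summable_Re_hcoeff_mult summable_Re_hcoeff_mult])
       (simp add: hcoeff_add algebra_simps)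
  have "Re (hcoeff (r *\<^sub>R f) n * cnj (hcoeff g n)) = r * Re (hcoeff f n * cnj (hcoeff g n))" for n
    by (simp add: hcoeff_scaleR algebra_simps)
  then show "inner (r *\<^sub>R f) g = r * inner f g"
    unfolding inner_hardy_def by (simp only: suminf_mult[OF summable_Re_hcoeff_mult])
  show "0 \<le> inner f f"
    unfolding inner_self_hardy by (rule suminf_nonneg[OF summable_hcoeff]) simp
  show "inner f f = 0 \<longleftrightarrow> f = 0"
  proof
    assume "inner f f = 0"
    then have "\<forall>n. (norm (hcoeff f n))\<^sup>2 = 0"
      unfolding inner_self_hardy suminf_eq_zero_iff[OF summable_hcoeff zero_le_power2] .
    then show "f = 0" by (intro hardy_eqI) (simp add: hcoeff_zero)
  qed (simp add: inner_self_hardy hcoeff_zero)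
qed

end

lemma hcoeff_diff: "hcoeff (f - g) n = hcoeff f n - hcoeff g n"
  unfolding minus_hardy_def hcoeff_add hcoeff_minus by simp

lemma norm_sq_hardy: "(norm (f :: hardy))\<^sup>2 = (\<Sum>n. (norm (hcoeff f n))\<^sup>2)"
  by (simp add: power2_norm_eq_inner inner_self_hardy)

lemma hcoeff_partial_sum_le: "(\<Sum>n<N. (norm (hcoeff f n))\<^sup>2) \<le> (norm f)\<^sup>2"
  unfolding norm_sq_hardy by (rule sum_le_suminf[OF summable_hcoeff]) auto

lemma norm_hcoeff_le: "norm (hcoeff f n) \<le> norm f"
proof -
  have "(norm (hcoeff f n))\<^sup>2 \<le> (\<Sum>k<Suc n. (norm (hcoeff f k))\<^sup>2)"
    by (rule member_le_sum) auto
  also have "\<dots> \<le> (norm f)\<^sup>2" by (rule hcoeff_partial_sum_le)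
  finally show ?thesis by (rule power2_le_imp_le) simp
qed

lemma hardy_of_partial_sums:
  assumes "\<And>N. (\<Sum>n<N. (norm (c n))\<^sup>2) \<le> B\<^sup>2" "B \<ge> 0"
  obtains f where "hcoeff f = c" "hfun f = from_coeffs c" "norm f \<le> B"
proof -
  have s: "summable (\<lambda>n. (norm (c n))\<^sup>2)"
    by (rule summableI_nonneg_bounded[OF _ assms(1)]) simp
  then obtain f where f: "hcoeff f = c" "hfun f = from_coeffs c"
    using hardy_of_coeffs by blast
  have "(norm f)\<^sup>2 \<le> B\<^sup>2"
    unfolding norm_sq_hardy f by (rule suminf_le_const[OF s assms(1)])
  then have "norm f \<le> B"
    using assms(2) by (rule power2_le_imp_le)
  with f that show thesis by blast
qed

text \<open>A Fatou argument: each finite partial sum of squares passes to the limit under the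
  common bound \<open>B\<close>. Coefficientwise limits therefore stay in the ball, without norm
  convergence.\<close>

lemma hardy_coeff_limit:
  assumes lim: "\<And>n. (\<lambda>k. hcoeff (F k) n) \<longlonglongrightarrow> c n"
    and B: "\<forall>\<^sub>F k in sequentially. norm (F k) \<le> B"
  obtains f where "hcoeff f = c" "norm f \<le> B"
proof -
  obtain k where "norm (F k) \<le> B"
    using eventually_happens'[OF sequentially_bot B] by blast
  then have B0: "B \<ge> 0" using norm_ge_zero[of "F k"] by linarith
  have "(\<Sum>n<N. (norm (c n))\<^sup>2) \<le> B\<^sup>2" for N
  proof (rule tendsto_upperbound)
    show "(\<lambda>k. \<Sum>n<N. (norm (hcoeff (F k) n))\<^sup>2) \<longlonglongrightarrow> (\<Sum>n<N. (norm (c n))\<^sup>2)"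
      by (intro tendsto_intros lim)
    show "\<forall>\<^sub>F k in sequentially. (\<Sum>n<N. (norm (hcoeff (F k) n))\<^sup>2) \<le> B\<^sup>2"
      using B
    proof eventually_elim
      case (elim k)
      have "(\<Sum>n<N. (norm (hcoeff (F k) n))\<^sup>2) \<le> (norm (F k))\<^sup>2"
        by (rule hcoeff_partial_sum_le)
      also have "\<dots> \<le> B\<^sup>2"
        by (rule power_mono[OF elim norm_ge_zero])
      finally show ?case .
    qed
  qed simp
  from hardy_of_partial_sums[of c B, OF this B0] obtain f where "hcoeff f = c" "norm f \<le> B"
    by blast
  with that show thesis by blast
qed

instance hardy :: banach
proof
  fix F :: "nat \<Rightarrow> hardy" assume F: "Cauchy F"
  have coeff_Cauchy: "Cauchy (\<lambda>k. hcoeff (F k) n)" for n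
  proof (rule metric_CauchyI)
    fix e :: real assume "e > 0"
    then obtain M where "\<forall>i\<ge>M. \<forall>j\<ge>M. dist (F i) (F j) < e"
      using F metric_CauchyD by blast
    moreover have "dist (hcoeff (F i) n) (hcoeff (F j) n) \<le> dist (F i) (F j)" for i j
      using norm_hcoeff_le[of "F i - F j" n] by (simp add: dist_norm hcoeff_diff)
    ultimately show "\<exists>M. \<forall>i\<ge>M. \<forall>j\<ge>M. dist (hcoeff (F i) n) (hcoeff (F j) n) < e"
      by (meson le_less_trans)
  qed
  define c where "c n = lim (\<lambda>k. hcoeff (F k) n)" for n
  have c: "(\<lambda>k. hcoeff (F k) n) \<longlonglongrightarrow> c n" for n
    unfolding c_def by (rule convergent_LIMSEQ_iff[THEN iffD1, OF Cauchy_convergent[OF coeff_Cauchy]])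
  obtain B where "\<And>k. norm (F k) \<le> B"
    using cauchy_imp_bounded[OF F] by (auto simp: bounded_iff)
  then have "\<forall>\<^sub>F k in sequentially. norm (F k) \<le> B"
    by (intro always_eventually allI)
  from hardy_coeff_limit[OF c this] obtain f where f: "hcoeff f = c"
    by blast
  have "F \<longlonglongrightarrow> f"
  proof (rule metric_LIMSEQ_I)
    fix e :: real assume e: "e > 0"
    then obtain M where M: "\<And>i j. i \<ge> M \<Longrightarrow> j \<ge> M \<Longrightarrow> dist (F i) (F j) < e/2"
      using metric_CauchyD[OF F, of "e/2"] by auto
    have "dist (F i) f < e" if i: "i \<ge> M" for i
    proof -
      \<comment> \<open>With \<open>i\<close> fixed and \<open>j\<close> tending to infinity, the
        coefficientwise limit of \<open>F i - F j\<close> is \<open>F i - f\<close> and inherits the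
        bound \<open>e/2\<close>.\<close>
      have "\<forall>\<^sub>F j in sequentially. norm (F i - F j) \<le> e/2"
        using eventually_ge_at_top[of M]
      proof eventually_elim
        case (elim j)
        show ?case using M[OF i elim] by (simp add: dist_norm)
      qed
      moreover have "(\<lambda>j. hcoeff (F i - F j) n) \<longlonglongrightarrow> hcoeff (F i) n - c n" for n
        unfolding hcoeff_diff by (intro tendsto_intros c)
      ultimately obtain h where h: "hcoeff h = (\<lambda>n. hcoeff (F i) n - c n)" "norm h \<le> e/2"
        using hardy_coeff_limit[of "\<lambda>j. F i - F j" "\<lambda>n. hcoeff (F i) n - c n" "e/2"] by blast
      have "h = F i - f"
        by (rule hardy_eqI) (simp add: h hcoeff_diff f)
      with h e show ?thesis by (simp add: dist_norm)
    qed
    then show "\<exists>M. \<forall>i\<ge>M. dist (F i) f < e" by blast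
  qed
  then show "convergent F" by (rule convergentI)
qed

section \<open>Bounded multipliers and their adjoints\<close>

lemma has_integral_cis_int:
  "((\<lambda>t. cis (of_int k * t)) has_integral (if k = 0 then 2 * of_real pi else 0)) {0..2*pi}"
proof (cases "k = 0")
  case True
  have "((\<lambda>t::real. 1 :: complex) has_integral (2 * pi - 0) *\<^sub>R 1) {0..2*pi}"
    using has_integral_const_real[of "1::complex" 0 "2*pi"] by simp
  then show ?thesis using True by (simp add: scaleR_conv_of_real)
next
  case False
  define F where "F z = exp (\<i> * of_int k * z) / (\<i> * of_int k)" for z :: complex
  have "(F has_field_derivative exp (\<i> * of_int k * z)) (at z)" for z
    unfolding F_def using False by (auto intro!: derivative_eq_intros simp: field_simps)
  then have "((\<lambda>t. F (of_real t)) has_vector_derivative exp (\<i> * of_int k * of_real t)) (at t within {0..2*pi})" for t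
    by (rule has_vector_derivative_real_field)
  then have "((\<lambda>t::real. exp (\<i> * of_int k * of_real t)) has_integral F (of_real (2 * pi)) - F (of_real 0)) {0..2*pi}"
    by (intro fundamental_theorem_of_calculus) auto
  moreover have "exp (\<i> * of_int k * of_real (2 * pi)) = 1"
    using exp_integer_2pi[of "of_int k"] by (simp add: mult_ac)
  then have "F (of_real (2 * pi)) - F (of_real 0) = 0"
    by (simp add: F_def)
  ultimately show ?thesis
    using False by (simp add: cis_conv_exp mult_ac)
qed

lemma trig_poly_parseval:
  fixes a :: "nat \<Rightarrow> complex"
  shows "((\<lambda>t. (norm (\<Sum>n<N. a n * cis (real n * t)))\<^sup>2) has_integral
      2 * pi * (\<Sum>n<N. (norm (a n))\<^sup>2)) {0..2*pi}"
proof -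
  let ?P = "\<lambda>t. \<Sum>n<N. a n * cis (real n * t)"
  have eq: "?P t * cnj (?P t) =
      (\<Sum>n<N. \<Sum>m<N. a n * cnj (a m) * cis (of_int (int n - int m) * t))" for t
  proof -
    have "?P t * cnj (?P t) = (\<Sum>n<N. \<Sum>m<N. (a n * cis (real n * t)) * cnj (a m * cis (real m * t)))"
      by (simp add: sum_product)
    also have "\<dots> = (\<Sum>n<N. \<Sum>m<N. a n * cnj (a m) * cis (of_int (int n - int m) * t))"
      by (intro sum.cong refl) (simp add: cis_cnj cis_mult algebra_simps)
    finally show ?thesis .
  qed
  have "((\<lambda>t. ?P t * cnj (?P t)) has_integral
      (\<Sum>n<N. \<Sum>m<N. a n * cnj (a m) * (if int n - int m = 0 then 2 * of_real pi else 0))) {0..2*pi}"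
    unfolding eq by (intro has_integral_sum has_integral_mult_right has_integral_cis_int finite_lessThan)
  also have "(\<Sum>n<N. \<Sum>m<N. a n * cnj (a m) * (if int n - int m = 0 then 2 * of_real pi else 0)) =
      (\<Sum>n<N. a n * cnj (a n) * (2 * of_real pi))"
  proof (intro sum.cong refl)
    fix n assume n: "n \<in> {..<N}"
    have "(\<Sum>m<N. a n * cnj (a m) * (if int n - int m = 0 then 2 * of_real pi else 0)) =
        (\<Sum>m<N. if n = m then a n * cnj (a m) * (2 * of_real pi) else 0)"
      by (intro sum.cong) auto
    then show "(\<Sum>m<N. a n * cnj (a m) * (if int n - int m = 0 then 2 * of_real pi else 0)) =
        a n * cnj (a n) * (2 * of_real pi)"
      using n by simp
  qed
  also have "\<dots> = of_real (2 * pi * (\<Sum>n<N. (norm (a n))\<^sup>2))"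
    by (simp add: sum_distrib_left complex_norm_square mult_ac del: of_real_power)
  finally have "((\<lambda>t. Re (?P t * cnj (?P t))) has_integral
      Re (of_real (2 * pi * (\<Sum>n<N. (norm (a n))\<^sup>2)))) {0..2*pi}"
    by (rule has_integral_linear[OF _ bounded_linear_Re, unfolded comp_def])
  then show ?thesis
    unfolding complex_norm_square[symmetric] Re_complex_of_real .
qed

text \<open>For r < 1 the power series converges absolutely on the circle, so its partial sums are
  uniformly bounded and dominated convergence extends the identity from trigonometric
  polynomials.\<close>

lemma circle_parseval:
  assumes hol: "f holomorphic_on disc" and r: "0 < r" "r < 1"
  shows "(\<lambda>t. (norm (f (of_real r * cis t)))\<^sup>2) integrable_on {0..2*pi}"
    and "(\<lambda>N. 2 * pi * (\<Sum>n<N. (norm (h2coeff f n))\<^sup>2 * r ^ (2 * n)))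
        \<longlonglongrightarrow> integral {0..2*pi} (\<lambda>t. (norm (f (of_real r * cis t)))\<^sup>2)"
proof -
  define a where "a n = h2coeff f n * of_real r ^ n" for n
  define P where "P N t = (\<Sum>n<N. a n * cis (real n * t))" for N t
  \<comment> \<open>Convergence at the larger radius \<open>R\<close> gives absolute convergence at
    \<open>r\<close>.\<close>
  obtain R where R: "r < R" "R < 1" using dense r by blast
  have "summable (\<lambda>n. h2coeff f n * of_real R ^ n)"
    using h2coeff_sums[OF hol, of "of_real R"] R r by (auto simp: sums_iff)
  then have sa: "summable (\<lambda>n. norm (a n))"
    unfolding a_def by (rule powser_insidea) (use R r in auto)
  have "(\<lambda>n. a n * cis (real n * t)) sums f (of_real r * cis t)" for t
  proof -
    have "(\<lambda>n. h2coeff f n * (of_real r * cis t) ^ n) sums f (of_real r * cis t)"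
      using r by (intro h2coeff_sums hol) (simp add: norm_mult)
    then show ?thesis
      by (simp add: a_def power_mult_distrib Complex.DeMoivre mult_ac)
  qed
  then have lim: "(\<lambda>N. P N t) \<longlonglongrightarrow> f (of_real r * cis t)" for t
    unfolding P_def sums_def .
  have int: "((\<lambda>t. (norm (P N t))\<^sup>2) has_integral 2 * pi * (\<Sum>n<N. (norm (a n))\<^sup>2)) {0..2*pi}" for N
    unfolding P_def by (rule trig_poly_parseval)
  have bd: "norm (P N t) \<le> (\<Sum>n. norm (a n))" for N t
  proof -
    have "norm (P N t) \<le> (\<Sum>n<N. norm (a n))"
      unfolding P_def by (rule sum_norm_le) (simp add: norm_mult)
    also have "\<dots> \<le> (\<Sum>n. norm (a n))"
      by (rule sum_le_suminf[OF sa]) auto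
    finally show ?thesis .
  qed
  have "norm ((norm (P N t))\<^sup>2) \<le> (\<Sum>n. norm (a n))\<^sup>2" for N t
    using bd[of N t] by (simp add: power_mono)
  moreover have "(\<lambda>N. (norm (P N t))\<^sup>2) \<longlonglongrightarrow> (norm (f (of_real r * cis t)))\<^sup>2" for t
    by (intro tendsto_intros lim)
  moreover have "(\<lambda>t. (norm (P N t))\<^sup>2) integrable_on {0..2*pi}" for N
    using int by (rule has_integral_integrable)
  ultimately have dom: "(\<lambda>t. (norm (f (of_real r * cis t)))\<^sup>2) integrable_on {0..2*pi}"
    "(\<lambda>N. integral {0..2*pi} (\<lambda>t. (norm (P N t))\<^sup>2))
      \<longlonglongrightarrow> integral {0..2*pi} (\<lambda>t. (norm (f (of_real r * cis t)))\<^sup>2)"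
    using dominated_convergence[where f = "\<lambda>N t. (norm (P N t))\<^sup>2" and S = "{0..2*pi}"
        and h = "\<lambda>_. (\<Sum>n. norm (a n))\<^sup>2" and g = "\<lambda>t. (norm (f (of_real r * cis t)))\<^sup>2"]
      integrable_const_ivl by blast+
  show "(\<lambda>t. (norm (f (of_real r * cis t)))\<^sup>2) integrable_on {0..2*pi}"
    by (rule dom)
  have "integral {0..2*pi} (\<lambda>t. (norm (P N t))\<^sup>2) =
      2 * pi * (\<Sum>n<N. (norm (h2coeff f n))\<^sup>2 * r ^ (2 * n))" for N
    using integral_unique[OF int[of N]] r
    by (simp add: a_def norm_mult norm_power power_mult_distrib power_even_eq)
  then show "(\<lambda>N. 2 * pi * (\<Sum>n<N. (norm (h2coeff f n))\<^sup>2 * r ^ (2 * n)))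
        \<longlonglongrightarrow> integral {0..2*pi} (\<lambda>t. (norm (f (of_real r * cis t)))\<^sup>2)"
    using dom(2) by simp
qed

text \<open>H-infinity with an explicit bound. Values outside the disc are left free, so that
  \<open>b\<close>, powers of \<phi> and rational functions qualify as they are; \<open>toep\<close>
  restricts the product.\<close>

definition multiplier :: "real \<Rightarrow> (complex \<Rightarrow> complex) \<Rightarrow> bool" where
  "multiplier M u \<longleftrightarrow> u holomorphic_on disc \<and> (\<forall>z\<in>disc. norm (u z) \<le> M)"

definition hmult :: "(complex \<Rightarrow> complex) \<Rightarrow> hardy \<Rightarrow> hardy" where
  "hmult u f = Hardy (toep u (hfun f))"

lemma multiplier_nonneg:
  assumes "multiplier M u"
  shows "M \<ge> 0"
proof -
  have "norm (u 0) \<le> M" using assms by (simp add: multiplier_def)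
  then show ?thesis using norm_ge_zero[of "u 0"] by linarith
qed

lemma toep_holomorphic:
  assumes "u holomorphic_on disc"
  shows "toep u (hfun f) holomorphic_on disc"
  unfolding toep_def disc_restrict_holomorphic_iff by (intro holomorphic_intros assms hfun_holomorphic)

text \<open>The pointwise bound on \<open>u\<close> is integrated over circles of radius r < 1 and
  translated by Parseval. Only finitely many coefficients are kept, so r can tend to 1 without any
  boundary values.\<close>

lemma toep_coeff_sum_le:
  assumes u: "multiplier M u"
  shows "(\<Sum>n<N. (norm (h2coeff (toep u (hfun f)) n))\<^sup>2) \<le> (M * norm f)\<^sup>2"
proof -
  let ?g = "toep u (hfun f)"
  have holg: "?g holomorphic_on disc"
    using u toep_holomorphic by (simp add: multiplier_def)
  have r_bound: "(\<Sum>n<N. (norm (h2coeff ?g n))\<^sup>2 * r ^ (2 * n)) \<le> (M * norm f)\<^sup>2"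
    if r: "0 < r" "r < 1" for r
  proof -
    let ?I = "\<lambda>h. integral {0..2*pi} (\<lambda>t. (norm (h (of_real r * cis t)))\<^sup>2)"
    have "2 * pi * (\<Sum>n<N. (norm (h2coeff ?g n))\<^sup>2 * r ^ (2 * n)) \<le> ?I ?g"
    proof (rule LIMSEQ_le_const[OF circle_parseval(2)[OF holg r]])
      show "\<exists>K. \<forall>k\<ge>K. 2 * pi * (\<Sum>n<N. (norm (h2coeff ?g n))\<^sup>2 * r ^ (2 * n)) \<le>
          2 * pi * (\<Sum>n<k. (norm (h2coeff ?g n))\<^sup>2 * r ^ (2 * n))"
        using r by (intro exI[of _ N] allI impI mult_left_mono sum_mono2) auto
    qed
    also have "?I ?g \<le> integral {0..2*pi} (\<lambda>t. M\<^sup>2 * (norm (hfun f (of_real r * cis t)))\<^sup>2)"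
    proof (rule integral_le[OF circle_parseval(1)[OF holg r]])
      show "(\<lambda>t. M\<^sup>2 * (norm (hfun f (of_real r * cis t)))\<^sup>2) integrable_on {0..2*pi}"
        by (intro integrable_on_mult_right circle_parseval(1) hfun_holomorphic r)
      fix t
      have "of_real r * cis t \<in> disc" using r by (simp add: norm_mult)
      then show "(norm (?g (of_real r * cis t)))\<^sup>2 \<le> M\<^sup>2 * (norm (hfun f (of_real r * cis t)))\<^sup>2"
        using u unfolding toep_def disc_restrict_def multiplier_def power_mult_distrib[symmetric]
        by (auto simp: norm_mult intro!: power_mono mult_right_mono)
    qed
    also have "\<dots> = M\<^sup>2 * ?I (hfun f)" by simp
    also have "?I (hfun f) \<le> 2 * pi * (norm f)\<^sup>2"
    proof (rule LIMSEQ_le_const2[OF circle_parseval(2)[OF hfun_holomorphic r]], intro exI allI impI)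
      fix k :: nat
      have "(\<Sum>n<k. (norm (hcoeff f n))\<^sup>2 * r ^ (2 * n)) \<le> (\<Sum>n<k. (norm (hcoeff f n))\<^sup>2)"
        using r by (intro sum_mono mult_left_le) (auto simp: power_le_one)
      also have "\<dots> \<le> (norm f)\<^sup>2" by (rule hcoeff_partial_sum_le)
      finally show "2 * pi * (\<Sum>n<k. (norm (h2coeff (hfun f) n))\<^sup>2 * r ^ (2 * n)) \<le> 2 * pi * (norm f)\<^sup>2"
        by (simp add: hcoeff_def)
    qed
    finally have "2 * pi * (\<Sum>n<N. (norm (h2coeff ?g n))\<^sup>2 * r ^ (2 * n)) \<le> M\<^sup>2 * (2 * pi * (norm f)\<^sup>2)"
      by (simp add: mult_left_mono)
    also have "\<dots> = 2 * pi * (M * norm f)\<^sup>2"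
      by (simp add: power_mult_distrib)
    finally show ?thesis by simp
  qed
  have lim: "((\<lambda>r. \<Sum>n<N. (norm (h2coeff ?g n))\<^sup>2 * r ^ (2 * n)) \<longlongrightarrow>
      (\<Sum>n<N. (norm (h2coeff ?g n))\<^sup>2 * 1 ^ (2 * n))) (at_left 1)"
    by (intro tendsto_intros)
  have "\<forall>\<^sub>F r::real in at_left 1. (\<Sum>n<N. (norm (h2coeff ?g n))\<^sup>2 * r ^ (2 * n)) \<le> (M * norm f)\<^sup>2"
    by (rule eventually_at_leftI[of 0]) (use r_bound in auto)
  from tendsto_upperbound[OF lim this] show ?thesis by simp
qed

lemma toep_in_H2:
  assumes u: "multiplier M u"
  shows "toep u (hfun f) \<in> H2"
proof -
  have "summable (\<lambda>n. (norm (h2coeff (toep u (hfun f)) n))\<^sup>2)"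
    by (rule summableI_nonneg_bounded[OF _ toep_coeff_sum_le[OF u]]) simp
  then show ?thesis
    using u toep_holomorphic[of u f]
    by (simp add: H2_def multiplier_def) (simp add: toep_def disc_restrict_def)
qed

lemma hfun_hmult_toep: "multiplier M u \<Longrightarrow> hfun (hmult u f) = toep u (hfun f)"
  unfolding hmult_def by (rule Hardy_inverse[OF toep_in_H2])

lemma hfun_hmult: "multiplier M u \<Longrightarrow> z \<in> disc \<Longrightarrow> hfun (hmult u f) z = u z * hfun f z"
  by (simp add: hfun_hmult_toep toep_def disc_restrict_def)

lemma norm_hmult_le:
  assumes u: "multiplier M u"
  shows "norm (hmult u f) \<le> M * norm f"
proof (rule power2_le_imp_le)
  show "(norm (hmult u f))\<^sup>2 \<le> (M * norm f)\<^sup>2"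
    unfolding norm_sq_hardy
    by (rule suminf_le_const[OF summable_hcoeff])
       (simp add: hcoeff_def hfun_hmult_toep[OF u] toep_coeff_sum_le[OF u])
  show "0 \<le> M * norm f"
    using multiplier_nonneg[OF u] by simp
qed

lemma hfun_scaleR: "hfun (r *\<^sub>R f) = (\<lambda>z. of_real r * hfun f z)"
  by (simp add: scaleR_hardy_def hfun_cscale)

lemma hfun_diff: "hfun (f - g) = (\<lambda>z. hfun f z - hfun g z)"
  unfolding minus_hardy_def hfun_add uminus_hardy_def hfun_cscale by simp

lemma hmult_cscale: "multiplier M u \<Longrightarrow> hmult u (cscale c f) = cscale c (hmult u f)"
  by (rule hardy_fun_eqI) (simp add: hfun_hmult hfun_cscale)

lemma bounded_linear_hmult:
  assumes u: "multiplier M u"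
  shows "bounded_linear (hmult u)"
proof (rule bounded_linear_intro)
  show "hmult u (f + g) = hmult u f + hmult u g" for f g
    by (rule hardy_fun_eqI) (simp add: hfun_hmult[OF u] hfun_add algebra_simps)
  show "hmult u (r *\<^sub>R f) = r *\<^sub>R hmult u f" for r f
    by (simp add: scaleR_hardy_def hmult_cscale[OF u])
  show "norm (hmult u f) \<le> norm f * M" for f
    using norm_hmult_le[OF u] by (simp add: mult.commute)
qed

lemma norm_cscale: "norm (cscale c f) = norm c * norm f"
proof -
  have "(norm (cscale c f))\<^sup>2 = (norm f * norm c)\<^sup>2"
    unfolding norm_sq_hardy power_mult_distrib suminf_mult2[OF summable_hcoeff]
    by (simp add: hcoeff_cscale norm_mult power_mult_distrib mult.commute)
  then show ?thesis by (simp add: power2_eq_iff_nonneg mult.commute)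
qed

lemma bounded_linear_cscale: "bounded_linear (cscale c)"
proof (rule bounded_linear_intro)
  show "cscale c (f + g) = cscale c f + cscale c g" for f g
    by (rule hardy_eqI) (simp add: hcoeff_cscale hcoeff_add algebra_simps)
  show "cscale c (r *\<^sub>R f) = r *\<^sub>R cscale c f" for r f
    by (rule hardy_eqI) (simp add: hcoeff_cscale hcoeff_scaleR)
  show "norm (cscale c f) \<le> norm f * norm c" for f
    by (simp add: norm_cscale mult.commute)
qed

section \<open>Complex inner product, monomials and reproducing kernels\<close>

lemma h2inner_sums:
  "(\<lambda>n. hcoeff f n * cnj (hcoeff g n)) sums h2inner (hfun f) (hfun g)"
  unfolding h2inner_def hcoeff_def[symmetric] by (rule summable_sums[OF summable_hcoeff_mult])

lemma Re_h2inner: "Re (h2inner (hfun f) (hfun g)) = inner f g"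
  unfolding inner_hardy_def by (rule sums_unique[OF sums_Re[OF h2inner_sums]])

lemma h2inner_cscale_right:
  "h2inner (hfun f) (hfun (cscale c g)) = cnj c * h2inner (hfun f) (hfun g)"
  using sums_unique2[OF h2inner_sums[of f "cscale c g"], of "cnj c * h2inner (hfun f) (hfun g)"]
    sums_mult[OF h2inner_sums, of "cnj c" f g]
  by (simp add: hcoeff_cscale mult_ac)

text \<open>Conjugate linearity in the second argument contributes a factor \<open>-\<i>\<close>,
  which rotates the imaginary part into the real part.\<close>

lemma Im_h2inner: "Im (h2inner (hfun f) (hfun g)) = inner f (cscale \<i> g)"
  by (simp add: h2inner_cscale_right flip: Re_h2inner)

lemma h2norm_hardy: "h2norm (hfun f) = norm f"
  unfolding h2norm_def norm_hardy_def inner_self_hardy hcoeff_def ..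

text \<open>Coefficients depend only on the germ at 0; this reconciles functions that differ outside
  the disc.\<close>

lemma h2coeff_cong:
  assumes "\<And>z. z \<in> disc \<Longrightarrow> f z = g z"
  shows "h2coeff f n = h2coeff g n"
proof -
  have "\<forall>\<^sub>F z in nhds 0. z \<in> disc"
    by (rule eventually_nhds_in_open) auto
  then have "\<forall>\<^sub>F z in nhds 0. f z = g z"
    by (rule eventually_mono) (rule assms)
  then have "(deriv ^^ n) f 0 = (deriv ^^ n) g 0"
    by (rule higher_deriv_cong_ev) simp
  then show ?thesis by (simp add: h2coeff_def)
qed

lemma h2inner_cscale_left:
  "h2inner (hfun (cscale c f)) (hfun g) = c * h2inner (hfun f) (hfun g)"
  using sums_unique2[OF h2inner_sums[of "cscale c f" g], of "c * h2inner (hfun f) (hfun g)"]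
    sums_mult[OF h2inner_sums, of c f g]
  by (simp add: hcoeff_cscale mult_ac)

definition hmon :: "nat \<Rightarrow> hardy" where
  "hmon n = Hardy (from_coeffs (\<lambda>m. if m = n then 1 else 0))"

lemma hmon_props:
  shows hcoeff_hmon: "hcoeff (hmon n) m = (if m = n then 1 else 0)"
    and hfun_hmon: "z \<in> disc \<Longrightarrow> hfun (hmon n) z = z ^ n"
proof -
  let ?c = "\<lambda>m. if m = n then 1 else 0 :: complex"
  have "summable (\<lambda>m. (norm (?c m))\<^sup>2)"
    by (rule summable_finite[of "{n}"]) auto
  note H = from_coeffs_in_H2[OF this]
  show *: "hcoeff (hmon n) m = ?c m" for m
    using H by (simp add: hcoeff_def hmon_def Hardy_inverse)
  assume "z \<in> disc"
  from hfun_sums[OF this, of "hmon n"] have "(\<lambda>m. if m = n then z ^ m else 0) sums hfun (hmon n) z"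
    by (simp add: * if_distrib[of "\<lambda>x. x * _"] cong: if_cong)
  then show "hfun (hmon n) z = z ^ n"
    using sums_unique2 sums_single by blast
qed

lemma hcoeff_sum: "hcoeff (\<Sum>i\<in>A. F i) n = (\<Sum>i\<in>A. hcoeff (F i) n)"
  by (induction A rule: infinite_finite_induct) (simp_all add: hcoeff_zero hcoeff_add)

lemma hcoeff_hmon_sum:
  "hcoeff (\<Sum>i<N. cscale (c i) (hmon i)) n = (if n < N then c n else 0)"
  by (simp add: hcoeff_sum hcoeff_cscale hcoeff_hmon if_distrib[of "\<lambda>x. _ * x"] cong: if_cong)

lemma norm_hmon_sum: "(norm (\<Sum>i<N. cscale (c i) (hmon i)))\<^sup>2 = (\<Sum>i<N. (norm (c i))\<^sup>2)"
proof -
  have "(\<lambda>n. (norm (hcoeff (\<Sum>i<N. cscale (c i) (hmon i)) n))\<^sup>2) sums (\<Sum>i<N. (norm (c i))\<^sup>2)"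
    using sums_If_finite_set[of "{..<N}" "\<lambda>n. (norm (c n))\<^sup>2"]
    by (simp add: hcoeff_hmon_sum if_distrib[of "\<lambda>x. (norm x)\<^sup>2"] cong: if_cong)
  then show ?thesis
    unfolding norm_sq_hardy by (rule sums_unique[symmetric])
qed

text \<open>The squared error of the N-th partial sum is exactly the tail of the convergent
  coefficient series.\<close>

lemma hmon_sums: "(\<lambda>n. cscale (hcoeff f n) (hmon n)) sums f"
proof -
  define P where "P N = (\<Sum>i<N. cscale (hcoeff f i) (hmon i))" for N
  have eq: "(norm (P N - f))\<^sup>2 = (norm f)\<^sup>2 - (\<Sum>i<N. (norm (hcoeff f i))\<^sup>2)" for N
  proof -
    have "(\<lambda>n. (norm (hcoeff f n))\<^sup>2 - (if n \<in> {..<N} then (norm (hcoeff f n))\<^sup>2 else 0)) sums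
        ((norm f)\<^sup>2 - (\<Sum>i<N. (norm (hcoeff f i))\<^sup>2))"
      unfolding norm_sq_hardy
      by (intro sums_diff summable_sums summable_hcoeff sums_If_finite_set) simp
    moreover have "(norm (hcoeff (P N - f) n))\<^sup>2 =
        (norm (hcoeff f n))\<^sup>2 - (if n \<in> {..<N} then (norm (hcoeff f n))\<^sup>2 else 0)" for n
      by (simp add: P_def hcoeff_diff hcoeff_hmon_sum)
    ultimately show ?thesis
      unfolding norm_sq_hardy[of "P N - f"] by (simp add: sums_iff)
  qed
  have "(\<lambda>N. (norm f)\<^sup>2 - (\<Sum>i<N. (norm (hcoeff f i))\<^sup>2)) \<longlonglongrightarrow> (norm f)\<^sup>2 - (norm f)\<^sup>2"
    unfolding norm_sq_hardy by (intro tendsto_diff tendsto_const summable_LIMSEQ summable_hcoeff)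
  then have "(\<lambda>N. sqrt ((norm (P N - f))\<^sup>2)) \<longlonglongrightarrow> sqrt 0"
    unfolding eq by (intro tendsto_real_sqrt) simp
  then have "P \<longlonglongrightarrow> f"
    by (simp add: tendsto_norm_zero_iff LIM_zero_iff)
  then show ?thesis by (simp add: sums_def P_def[abs_def])
qed

text \<open>The Szego kernel 1 / (1 - conj(a) z), given by its Taylor coefficients; pairing with it
  evaluates at \<open>a\<close>.\<close>

definition hker :: "complex \<Rightarrow> hardy" where
  "hker a = Hardy (from_coeffs (\<lambda>n. cnj a ^ n))"

context
  fixes a :: complex
  assumes a: "a \<in> disc"
begin

lemma hcoeff_hker: "hcoeff (hker a) n = cnj a ^ n"
proof -
  have "(norm a)\<^sup>2 < 1"
    using a by (simp add: power_less_one_iff)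
  then have "summable (\<lambda>n. ((norm a)\<^sup>2) ^ n)"
    by (intro summable_geometric) simp
  then have "summable (\<lambda>n. (norm (cnj a ^ n))\<^sup>2)"
    by (simp add: norm_power power_mult[symmetric] mult.commute)
  from from_coeffs_in_H2[OF this] show ?thesis
    by (simp add: hcoeff_def hker_def Hardy_inverse)
qed

lemma hfun_hker:
  assumes z: "z \<in> disc"
  shows "hfun (hker a) z = 1 / (1 - cnj a * z)"
proof -
  have "norm (cnj a * z) < 1"
    using a z norm_mult_less[of "cnj a" 1 z 1] by simp
  then have "(\<lambda>n. (cnj a * z) ^ n) sums (1 / (1 - cnj a * z))"
    by (rule geometric_sums)
  then show ?thesis
    using hfun_sums[OF z, of "hker a"]
    by (simp add: hcoeff_hker power_mult_distrib sums_iff)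
qed

lemma hfun_eq_h2inner: "hfun f a = h2inner (hfun f) (hfun (hker a))"
  using h2inner_sums[of f "hker a"] hfun_sums[OF a, of f]
  by (simp add: hcoeff_hker sums_iff)

end

text \<open>Point evaluation is continuous because its real and imaginary parts are inner products
  with fixed vectors.\<close>

lemma tendsto_hfun:
  assumes "(F \<longlongrightarrow> f) net"
  shows "((\<lambda>n. hfun (F n) z) \<longlongrightarrow> hfun f z) net"
proof (cases "z \<in> disc")
  case True
  have "hfun g z = Complex (inner g (hker z)) (inner g (cscale \<i> (hker z)))" for g
    by (simp add: complex_eq_iff hfun_eq_h2inner[OF True] Re_h2inner Im_h2inner)
  then show ?thesis
    by (simp add: tendsto_Complex tendsto_inner assms)
next
  case False
  then show ?thesis by (simp add: hfun_outside)
qed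

text \<open>Follows the coefficient formula of \<open>toep_conj\<close> so as to match
  \<open>defect_op\<close>. That the result lies in H2 and is the adjoint of \<open>hmult u\<close>
  has to be proved.\<close>

definition hadj :: "(complex \<Rightarrow> complex) \<Rightarrow> hardy \<Rightarrow> hardy" where
  "hadj u f = Hardy (toep_conj u (hfun f))"

context
  fixes M u
  assumes u: "multiplier M u"
begin

text \<open>Since u = u * 1 on the disc, the coefficients of a multiplier are those of an H2
  function, hence bounded.\<close>

lemma h2coeff_hmult_1: "h2coeff u n = hcoeff (hmult u (hmon 0)) n"
  unfolding hcoeff_def by (rule h2coeff_cong) (simp add: hfun_hmult[OF u] hfun_hmon)

lemma hcoeff_hmult_hmon: "hcoeff (hmult u (hmon n)) m = (if m < n then 0 else h2coeff u (m - n))"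
proof -
  define d where "d m = (if m < n then 0 else h2coeff u (m - n))" for m
  have bd: "norm (d m) \<le> norm (hmult u (hmon 0))" for m
    by (simp add: d_def h2coeff_hmult_1 norm_hcoeff_le)
  have "from_coeffs d z = hfun (hmult u (hmon n)) z" if z: "z \<in> disc" for z
  proof -
    have "u holomorphic_on disc" using u by (simp add: multiplier_def)
    from sums_mult[OF h2coeff_sums[OF this z], of "z ^ n"]
    have "(\<lambda>k. d (k + n) * z ^ (k + n)) sums (z ^ n * u z)"
      by (simp add: d_def power_add mult_ac)
    then have "(\<lambda>k. d k * z ^ k) sums (z ^ n * u z)"
      using sums_iff_shift[of "\<lambda>k. d k * z ^ k" n "z ^ n * u z"] by (simp add: d_def)
    then show ?thesis
      using z by (simp add: from_coeffs_def disc_restrict_def sums_iff hfun_hmult[OF u] hfun_hmon)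
  qed
  then have "h2coeff (from_coeffs d) m = hcoeff (hmult u (hmon n)) m"
    unfolding hcoeff_def by (rule h2coeff_cong)
  then show ?thesis
    using h2coeff_from_coeffs[of d, OF bd, of m] by (simp add: d_def)
qed

text \<open>The n-th coefficient of P_+(conj(u) f) is the pairing of f with u z^n. The first n terms
  of that pairing vanish, which produces the index shift \<open>n + k\<close>.\<close>

lemma toep_conj_coeff_sums:
  "(\<lambda>k. cnj (h2coeff u k) * h2coeff (hfun f) (n + k)) sums h2inner (hfun f) (hfun (hmult u (hmon n)))"
proof -
  have "(\<lambda>m. hcoeff f m * cnj (hcoeff (hmult u (hmon n)) m)) sums
      (h2inner (hfun f) (hfun (hmult u (hmon n))) + (\<Sum>m<n. hcoeff f m * cnj (hcoeff (hmult u (hmon n)) m)))"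
    using h2inner_sums[of f "hmult u (hmon n)"] by (simp add: hcoeff_hmult_hmon)
  then have "(\<lambda>k. hcoeff f (k + n) * cnj (hcoeff (hmult u (hmon n)) (k + n))) sums
      h2inner (hfun f) (hfun (hmult u (hmon n)))"
    by (rule sums_iff_shift[of "\<lambda>m. hcoeff f m * cnj (hcoeff (hmult u (hmon n)) m)" n, THEN iffD2])
  then have "(\<lambda>k. hcoeff f (k + n) * cnj (h2coeff u k)) sums h2inner (hfun f) (hfun (hmult u (hmon n)))"
    by (simp add: hcoeff_hmult_hmon)
  then show ?thesis
    by (simp add: hcoeff_def mult.commute add.commute)
qed

lemma inner_hmult_cscale_hmon:
  "inner f (hmult u (cscale c (hmon n))) = Re (cnj c * h2inner (hfun f) (hfun (hmult u (hmon n))))"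
  by (simp only: hmult_cscale[OF u] h2inner_cscale_right flip: Re_h2inner)

lemma hadj_coeffs:
  shows hfun_hadj: "hfun (hadj u f) = toep_conj u (hfun f)"
    and hcoeff_hadj: "hcoeff (hadj u f) n = h2inner (hfun f) (hfun (hmult u (hmon n)))"
proof -
  define c where "c n = h2inner (hfun f) (hfun (hmult u (hmon n)))" for n
  have tc: "toep_conj u (hfun f) = from_coeffs c"
    unfolding toep_conj_def c_def by (simp add: sums_unique[OF toep_conj_coeff_sums, symmetric])
  have "(\<Sum>n<N. (norm (c n))\<^sup>2) \<le> (M * norm f)\<^sup>2" for N
  proof -
    \<comment> \<open>Duality: testing \<open>f\<close> against \<open>u * p\<close> gives
      \<open>(norm p)\<^sup>2 = inner f (hmult u p)\<close>, which is at most
      \<open>norm f * M * norm p\<close>. Cancelling one factor \<open>norm p\<close> bounds the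
      coefficients uniformly in \<open>N\<close>.\<close>
    define p where "p = (\<Sum>i<N. cscale (c i) (hmon i))"
    define s where "s = (\<Sum>n<N. (norm (c n))\<^sup>2)"
    have s: "s = (norm p)\<^sup>2"
      by (simp add: s_def p_def norm_hmon_sum)
    have "s = inner f (hmult u p)"
      unfolding p_def s_def linear_sum[OF bounded_linear.linear[OF bounded_linear_hmult[OF u]]]
        inner_sum_right inner_hmult_cscale_hmon c_def[symmetric]
      by (simp add: mult.commute[of "cnj _"] flip: complex_norm_square)
    also have "\<dots> \<le> norm f * norm (hmult u p)"
      by (rule norm_cauchy_schwarz)
    also have "\<dots> \<le> norm f * (M * norm p)"
      by (intro mult_left_mono norm_hmult_le[OF u]) simp
    finally have "norm p * norm p \<le> (M * norm f) * norm p"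
      by (simp add: s power2_eq_square mult_ac)
    then have "norm p \<le> M * norm f"
      using multiplier_nonneg[OF u] by (cases "norm p = 0") (auto simp: mult_le_cancel_right)
    then show ?thesis
      unfolding s_def[symmetric] s by (rule power_mono) simp
  qed
  then obtain g where g: "hcoeff g = c" "hfun g = from_coeffs c"
    using hardy_of_partial_sums[of c "M * norm f"] multiplier_nonneg[OF u] by auto
  have "hadj u f = g"
    unfolding hadj_def tc g(2)[symmetric] by (rule hfun_inverse)
  then show "hfun (hadj u f) = toep_conj u (hfun f)"
    "hcoeff (hadj u f) n = h2inner (hfun f) (hfun (hmult u (hmon n)))"
    using g by (simp_all add: tc c_def)
qed

text \<open>Known for monomials from the coefficient formula; the general case expands
  \<open>g\<close> in monomials.\<close>

lemma inner_hadj: "inner (hadj u f) g = inner f (hmult u g)"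
proof -
  have "(\<lambda>n. inner f (hmult u (cscale (hcoeff g n) (hmon n)))) sums inner f (hmult u g)"
    by (intro bounded_linear.sums[OF bounded_linear_inner_right]
        bounded_linear.sums[OF bounded_linear_hmult[OF u]] hmon_sums)
  moreover have "inner f (hmult u (cscale (hcoeff g n) (hmon n))) =
      Re (hcoeff (hadj u f) n * cnj (hcoeff g n))" for n
    by (simp only: inner_hmult_cscale_hmon hcoeff_hadj mult.commute)
  ultimately show ?thesis
    unfolding inner_hardy_def[of "hadj u f"] by (simp add: sums_iff)
qed

lemma norm_hadj_le: "norm (hadj u f) \<le> M * norm f"
proof -
  have "norm (hadj u f) * norm (hadj u f) = inner f (hmult u (hadj u f))"
    by (simp add: inner_hadj[symmetric] power2_norm_eq_inner flip: power2_eq_square)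
  also have "\<dots> \<le> norm f * norm (hmult u (hadj u f))"
    by (rule norm_cauchy_schwarz)
  also have "\<dots> \<le> norm f * (M * norm (hadj u f))"
    by (intro mult_left_mono norm_hmult_le[OF u]) simp
  finally have "norm (hadj u f) * norm (hadj u f) \<le> (M * norm f) * norm (hadj u f)"
    by (simp add: mult_ac)
  then show ?thesis
    using multiplier_nonneg[OF u]
    by (cases "norm (hadj u f) = 0") (auto simp: mult_le_cancel_right)
qed

lemma bounded_linear_hadj: "bounded_linear (hadj u)"
proof (rule bounded_linear_intro)
  show "hadj u (f + g) = hadj u f + hadj u g" for f g
    by (rule vector_eq_rdot[THEN iffD1]) (simp add: inner_hadj inner_add_left)
  show "hadj u (r *\<^sub>R f) = r *\<^sub>R hadj u f" for r f
    by (rule vector_eq_rdot[THEN iffD1]) (simp add: inner_hadj)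
  show "norm (hadj u f) \<le> norm f * M" for f
    using norm_hadj_le[of f] by (simp add: mult.commute)
qed

lemma hadj_cscale: "hadj u (cscale c f) = cscale c (hadj u f)"
  by (rule hardy_eqI) (simp add: hcoeff_cscale hcoeff_hadj h2inner_cscale_left)

end

section \<open>The square root of the defect operator\<close>

lemma inner_cscale_ii: "inner (cscale \<i> f) (cscale \<i> g) = inner f g"
  by (simp add: h2inner_cscale_left h2inner_cscale_right flip: Re_h2inner)

lemma cscale_cscale: "cscale c (cscale d f) = cscale (c * d) f"
  by (rule hardy_eqI) (simp add: hcoeff_cscale)

lemma cscale_minus_one: "cscale (- 1) f = - f"
  by (simp add: uminus_hardy_def)

text \<open>Over the complex field a real quadratic form forces symmetry, by polarisation.\<close>
lemma symmetric_if_real_form: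
  assumes R: "linear R" "\<And>c f. R (cscale c f) = cscale c (R f)"
    and real: "\<And>f. h2inner (hfun (R f)) (hfun f) \<in> \<real>"
  shows "inner (R f) g = inner f (R g)"
proof -
  let ?i = "cscale \<i>"
  have lin_i: "linear ?i" by (rule bounded_linear.linear[OF bounded_linear_cscale])
  have 0: "inner (R f) (?i f) = 0" for f
    using real[of f] by (simp add: complex_is_Real_iff Im_h2inner)
  have "inner (R f) (?i h) + inner (R h) (?i f) = 0" for h
    using 0[of "f + h"] 0[of f] 0[of h]
    by (simp add: linear_add[OF R(1)] linear_add[OF lin_i] inner_add_left inner_add_right)
  from this[of "?i g"] show ?thesis
    by (simp add: cscale_cscale cscale_minus_one R(2) inner_cscale_ii inner_commute)
qed

text \<open>Discharges the definite description behind \<open>pos_sqrt_op\<close>, by existence from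
  the binomial series and uniqueness among all admissible roots; afterwards only the abstract
  properties of \<open>S\<close> are used.\<close>

lemma pos_sqrt_op_defect:
  assumes b: "b \<in> Hinf_ball"
  obtains S where "bounded_linear S" "\<And>f g. inner (S f) g = inner f (S g)"
    "\<And>c f. S (cscale c f) = cscale c (S f)"
    "\<And>f. pos_sqrt_op (defect_op b) (hfun f) = hfun (S f)"
proof -
  have u: "multiplier 1 b"
    using b by (simp add: Hinf_ball_def multiplier_def)
  define X where "X f = hmult b (hadj b f)" for f
  interpret symmetric_contraction X
  proof (rule symmetric_contraction.intro)
    show "bounded_linear X"
      unfolding X_def[abs_def] using bounded_linear_compose[OF bounded_linear_hmult[OF u] bounded_linear_hadj[OF u]] .
    show "norm (X f) \<le> norm f" for f
      unfolding X_def using norm_hmult_le[OF u, of "hadj b f"] norm_hadj_le[OF u, of f] by simp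
    show "inner (X f) g = inner f (X g)" for f g
    proof -
      have "inner (X f) g = inner (hadj b f) (hadj b g)"
        unfolding X_def by (metis inner_commute inner_hadj[OF u])
      then show ?thesis
        by (simp add: X_def inner_hadj[OF u])
    qed
  qed
  have X_cscale: "X (cscale c f) = cscale c (X f)" for c f
    by (simp add: X_def hadj_cscale[OF u] hmult_cscale[OF u])
  have root_cscale: "defect_root (cscale c f) = cscale c (defect_root f)" for c f
    by (rule defect_root_commute[OF bounded_linear_cscale, symmetric]) (simp add: X_cscale)
  have defect: "defect_op b (hfun f) = hfun (f - X f)" for f
    by (simp add: defect_op_def hfun_diff X_def hfun_hmult_toep[OF u] hfun_hadj[OF u])
  \<comment> \<open>The default 0 off H2 is prescribed by \<open>is_pos_sqrt_op\<close>; it makes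
    the root unique as a total function.\<close>
  define T where "T f = (if f \<in> H2 then hfun (defect_root (Hardy f)) else (\<lambda>_. 0))" for f
  have T_hfun: "T (hfun f) = hfun (defect_root f)" for f
    by (simp add: T_def hfun hfun_inverse)
  have T: "is_pos_sqrt_op (defect_op b) T"
    unfolding is_pos_sqrt_op_def
  proof (intro conjI ballI allI impI)
    fix f assume f: "f \<in> H2"
    then obtain h where h: "f = hfun h" using hfun_cases by metis
    show "T f \<in> H2" by (simp add: h T_hfun hfun)
    show "T (T f) = defect_op b f"
      by (simp add: h T_hfun defect_root_defect_root defect)
    show "T (\<lambda>z. c * f z) = (\<lambda>z. c * T f z)" for c
      by (simp add: h T_hfun root_cscale flip: hfun_cscale)
    show "T (\<lambda>z. f z + g z) = (\<lambda>z. T f z + T g z)" if "g \<in> H2" for g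
    proof -
      obtain k where k: "g = hfun k" using hfun_cases[OF \<open>g \<in> H2\<close>] by metis
      show ?thesis
        by (simp add: h k T_hfun linear_add[OF bounded_linear.linear[OF bounded_linear_defect_root]]
            flip: hfun_add)
    qed
    \<comment> \<open>Multiplication by \<open>\<i>\<close> is an isometry commuting with the
      symmetric root, so this quantity equals its own negative.\<close>
    have "inner (defect_root h) (cscale \<i> h) = 0"
    proof -
      have "inner (defect_root h) (cscale \<i> h) = inner (cscale \<i> (defect_root h)) (cscale \<i> (cscale \<i> h))"
        by (simp add: inner_cscale_ii)
      also have "\<dots> = - inner (defect_root (cscale \<i> h)) h"
        by (simp add: cscale_cscale cscale_minus_one root_cscale)
      also have "\<dots> = - inner (defect_root h) (cscale \<i> h)"
        by (metis inner_commute inner_defect_root)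
      finally show ?thesis by simp
    qed
    then show "h2inner (T f) f \<in> \<real>"
      by (simp add: h T_hfun complex_is_Real_iff Im_h2inner)
    show "Re (h2inner (T f) f) \<ge> 0"
      by (simp add: h T_hfun Re_h2inner defect_root_nonneg)
  next
    show "T f = (\<lambda>_. 0)" if "f \<notin> H2" for f
      using that by (simp add: T_def)
    have "h2norm (T f) \<le> (\<Sum>n. \<bar>sqrt_coeff n\<bar>) * h2norm f" if f: "f \<in> H2" for f
    proof -
      obtain h where h: "f = hfun h" using hfun_cases[OF f] by metis
      show ?thesis by (simp add: h T_hfun h2norm_hardy norm_defect_root_le)
    qed
    then show "\<exists>K. \<forall>f\<in>H2. h2norm (T f) \<le> K * h2norm f" by blast
  qed
  have unique: "T' = T" if T': "is_pos_sqrt_op (defect_op b) T'" for T'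
  proof -
    define R where "R f = Hardy (T' (hfun f))" for f
    note D = T'[unfolded is_pos_sqrt_op_def]
    have R: "hfun (R f) = T' (hfun f)" for f
      unfolding R_def using D hfun by (intro Hardy_inverse) blast
    have R_add: "R (f + g) = R f + R g" for f g
    proof -
      have "T' (\<lambda>z. hfun f z + hfun g z) = (\<lambda>z. T' (hfun f) z + T' (hfun g) z)"
        using D hfun by blast
      then have "hfun (R (f + g)) = hfun (R f + R g)"
        by (simp add: R hfun_add)
      then show ?thesis by (simp add: hfun_inject)
    qed
    have R_cscale: "R (cscale c f) = cscale c (R f)" for c f
    proof -
      have "T' (\<lambda>z. c * hfun f z) = (\<lambda>z. c * T' (hfun f) z)"
        using D hfun by blast
      then have "hfun (R (cscale c f)) = hfun (cscale c (R f))"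
        by (simp add: R hfun_cscale)
      then show ?thesis by (simp add: hfun_inject)
    qed
    obtain K where K: "\<And>f. f \<in> H2 \<Longrightarrow> h2norm (T' f) \<le> K * h2norm f"
      using D by blast
    have bl: "bounded_linear R"
    proof (rule bounded_linear_intro)
      show "R (f + g) = R f + R g" for f g by (rule R_add)
      show "R (r *\<^sub>R f) = r *\<^sub>R R f" for r f by (simp add: scaleR_hardy_def R_cscale)
      show "norm (R f) \<le> norm f * K" for f
        using K[OF hfun, of f] by (simp add: h2norm_hardy mult.commute flip: R)
    qed
    note lin = bounded_linear.linear[OF bl]
    have real: "h2inner (hfun (R f)) (hfun f) \<in> \<real>" "Re (h2inner (hfun (R f)) (hfun f)) \<ge> 0" for f
      using D hfun[of f] by (simp_all add: R)
    have sq: "R (R f) = f - X f" for f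
    proof -
      have "T' (T' (hfun f)) = defect_op b (hfun f)"
        using D hfun by blast
      then have "hfun (R (R f)) = hfun (f - X f)"
        by (simp only: R defect)
      then show ?thesis by (simp add: hfun_inject)
    qed
    \<comment> \<open>X = I - R^2 is a polynomial in R; this is the commutation that carries over to
      the series.\<close>
    have "R (X f) = X (R f)" for f
    proof -
      have "X g = g - R (R g)" for g by (simp add: sq)
      then show ?thesis by (simp add: linear_diff[OF lin])
    qed
    then have comm: "R (defect_root f) = defect_root (R f)" for f
      by (rule defect_root_commute[OF bl])
    have "R f = defect_root f" for f
    proof (rule positive_root_unique[of defect_root R])
      show "linear defect_root" by (rule bounded_linear.linear[OF bounded_linear_defect_root])
      show "inner (R f) g = inner f (R g)" for f g
        by (rule symmetric_if_real_form[OF lin R_cscale real(1)])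
      show "0 \<le> inner (R f) f" for f
        using real(2)[of f] by (simp add: Re_h2inner)
    qed (rule inner_defect_root defect_root_nonneg lin comm | simp add: sq defect_root_defect_root)+
    then have eq: "T' (hfun f) = T (hfun f)" for f
      by (simp add: T_hfun flip: R)
    show ?thesis
    proof
      fix f
      show "T' f = T f"
      proof (cases "f \<in> H2")
        case True
        then obtain h where "f = hfun h" using hfun_cases by metis
        then show ?thesis by (simp add: eq)
      next
        case False
        then show ?thesis using D by (simp add: T_def)
      qed
    qed
  qed
  have "pos_sqrt_op (defect_op b) = T"
    unfolding pos_sqrt_op_def using T unique by (rule the_equality)
  then show thesis
    using that[of defect_root] bounded_linear_defect_root inner_defect_root root_cscale T_hfun by auto
qed

section \<open>Composition operators\<close>

text \<open>Allows the closed disc, because it is also needed at the boundary fixed points.\<close>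

lemma one_minus_cnj_mult_bound:
  fixes a z :: complex
  assumes "norm z \<le> 1"
  shows "1 - norm a \<le> norm (1 - cnj a * z)"
proof -
  have "norm (cnj a * z) \<le> norm a"
    using assms by (simp add: norm_mult mult_left_le)
  then show ?thesis
    using norm_triangle_ineq2[of 1 "cnj a * z"] by simp
qed

text \<open>After moving the zero \<open>a\<close> of \<phi> to the origin, the Schwarz lemma
  applies to the resulting self-map \<open>g\<close> and to its inverse \<open>h\<close>; both being
  contractive forces \<open>g\<close> to be a rotation.\<close>

lemma disc_aut_moebius:
  assumes "disc_aut \<phi>"
  obtains a l where "a \<in> disc" "norm l = 1" "\<And>z. z \<in> disc \<Longrightarrow> \<phi> z = l * (z - a) / (1 - cnj a * z)"
proof -
  have hol: "\<phi> holomorphic_on disc" and inj: "inj_on \<phi> disc" and im: "\<phi> ` disc = disc"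
    using assms by (auto simp: disc_aut_def bij_betw_def)
  have "0 \<in> \<phi> ` disc" using im by simp
  then obtain a where a: "a \<in> disc" "\<phi> a = 0" by auto
  obtain \<psi> where \<psi>: "\<psi> holomorphic_on disc" "\<And>z. z \<in> disc \<Longrightarrow> \<psi> (\<phi> z) = z"
    using holomorphic_has_inverse[OF hol open_ball inj] im by metis
  have \<psi>_disc: "\<psi> z \<in> disc" if "z \<in> disc" for z
    using that \<psi>(2) im by (metis imageE)
  have \<phi>_disc: "\<phi> z \<in> disc" if "z \<in> disc" for z
    using that im by blast
  define m where "m = Moebius_function 0 a"
  define n where "n = Moebius_function 0 (- a)"
  have m: "m holomorphic_on disc" "\<And>z. z \<in> disc \<Longrightarrow> m z \<in> disc" "m a = 0"
    using a by (simp_all add: m_def Moebius_function_holomorphic Moebius_function_norm_lt_1 Moebius_function_eq_zero)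
  have n: "n holomorphic_on disc" "\<And>z. z \<in> disc \<Longrightarrow> n z \<in> disc" "n 0 = a"
    using a by (simp_all add: n_def Moebius_function_holomorphic Moebius_function_norm_lt_1 Moebius_function_of_zero)
  have mn: "m (n z) = z" if "z \<in> disc" for z
    using that a Moebius_function_compose[of a "- a" z] by (simp add: m_def n_def)
  have nm: "n (m z) = z" if "z \<in> disc" for z
    using that a Moebius_function_compose[of "- a" a z] by (simp add: m_def n_def)
  define g where "g = \<phi> \<circ> n"
  define h where "h = m \<circ> \<psi>"
  have g: "g holomorphic_on disc" "g 0 = 0" "\<And>z. norm z < 1 \<Longrightarrow> norm (g z) < 1"
    using n a \<phi>_disc unfolding g_def
    by (auto intro!: holomorphic_on_compose_gen[OF n(1) hol])
  have "\<psi> 0 = a" using \<psi>(2)[OF a(1)] a by simp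
  then have h: "h holomorphic_on disc" "h 0 = 0" "\<And>z. norm z < 1 \<Longrightarrow> norm (h z) < 1"
    using m a \<psi>_disc unfolding h_def
    by (auto intro!: holomorphic_on_compose_gen[OF \<psi>(1) m(1)])
  have hg: "h (g z) = z" if "z \<in> disc" for z
    using that by (simp add: h_def g_def \<psi>(2)[OF n(2)[OF that]] mn[OF that])
  \<comment> \<open>Any nonzero test point would do: equality in the Schwarz lemma at one such point
    already gives a rotation.\<close>
  let ?w = "1/2 :: complex"
  have w: "norm ?w < 1" by (simp add: norm_divide)
  have "norm (g ?w) \<le> norm ?w"
    by (rule Schwarz_Lemma(1)[OF g w])
  moreover have "norm (h (g ?w)) \<le> norm (g ?w)"
    by (rule Schwarz_Lemma(1)[OF h g(3)[OF w]])
  ultimately have "norm (g ?w) = norm ?w"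
    using hg[of ?w] w by simp
  then have "\<exists>z. norm z < 1 \<and> z \<noteq> 0 \<and> norm (g z) = norm z"
    using w by (intro exI[of _ ?w]) simp
  then obtain l where l: "\<And>z. norm z < 1 \<Longrightarrow> g z = l * z" "norm l = 1"
    using Schwarz_Lemma(3)[OF g, of 0] by auto
  have "\<phi> z = l * (z - a) / (1 - cnj a * z)" if z: "z \<in> disc" for z
  proof -
    have "\<phi> z = g (m z)" by (simp add: g_def nm[OF z])
    also have "\<dots> = l * m z" using m(2)[OF z] l(1) by simp
    finally show ?thesis by (simp add: m_def Moebius_function_simple)
  qed
  with a(1) l(2) that show thesis by blast
qed

section \<open>Boundedness of composition operators\<close>

text \<open>
  Littlewood's subordination argument, with the reproducing kernel at the zero \<open>a\<close> of \<open>\<phi>\<close> in place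
  of the constant function: \<open>hker a\<close> is orthogonal to \<open>\<phi> H2\<close>, so the coefficients of a polynomial
  can be peeled off one at a time.
\<close>
lemma kernel_subordination:
  assumes \<phi>: "multiplier 1 \<phi>" and a: "a \<in> disc" "\<phi> a = 0"
  shows "(norm (\<Sum>i<N. cscale (c i) (hmult (\<lambda>z. \<phi> z ^ i) (hker a))))\<^sup>2 \<le>
      (norm (hker a))\<^sup>2 * (\<Sum>i<N. (norm (c i))\<^sup>2)"
proof (induction N arbitrary: c)
  case (Suc N)
  let ?w = "\<lambda>i. hmult (\<lambda>z. \<phi> z ^ i) (hker a)"
  define h where "h = (\<Sum>i<N. cscale (c (Suc i)) (?w i))"
  define k where "k = cscale (c 0) (hker a)"
  have pow: "multiplier 1 (\<lambda>z. \<phi> z ^ i)" for i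
    using \<phi> by (auto simp: multiplier_def norm_power power_le_one intro!: holomorphic_intros)
  have w_Suc: "?w (Suc i) = hmult \<phi> (?w i)" for i
    by (rule hardy_fun_eqI) (simp add: hfun_hmult[OF pow] hfun_hmult[OF \<phi>] hfun_hmult[OF pow[of "Suc i", simplified]])
  have w_0: "?w 0 = hker a"
    using pow[of 0] by (intro hardy_fun_eqI) (simp add: hfun_hmult)
  have "(\<Sum>i<Suc N. cscale (c i) (?w i)) = k + (\<Sum>i<N. cscale (c (Suc i)) (?w (Suc i)))"
    by (subst sum.lessThan_Suc_shift) (simp only: k_def w_0)
  also have "(\<Sum>i<N. cscale (c (Suc i)) (?w (Suc i))) = hmult \<phi> h"
    unfolding h_def w_Suc linear_sum[OF bounded_linear.linear[OF bounded_linear_hmult[OF \<phi>]]]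
    by (simp add: hmult_cscale[OF \<phi>])
  finally have split: "(\<Sum>i<Suc N. cscale (c i) (?w i)) = k + hmult \<phi> h" .
  \<comment> \<open>Reproducing property at \<open>a\<close>, where \<phi> vanishes; Pythagoras then
    splits off \<open>c 0\<close>, and multiplication by \<phi> is a contraction.\<close>
  have "h2inner (hfun (hmult \<phi> h)) (hfun k) = cnj (c 0) * hfun (hmult \<phi> h) a"
    unfolding k_def h2inner_cscale_right hfun_eq_h2inner[OF a(1)] ..
  also have "\<dots> = 0" using a by (simp add: hfun_hmult[OF \<phi>])
  finally have orth: "inner (hmult \<phi> h) k = 0"
    by (simp flip: Re_h2inner)
  have "(norm (k + hmult \<phi> h))\<^sup>2 = (norm k)\<^sup>2 + (norm (hmult \<phi> h))\<^sup>2"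
    using orth by (simp add: power2_norm_eq_inner inner_add_left inner_add_right inner_commute)
  also have "(norm (hmult \<phi> h))\<^sup>2 \<le> (norm h)\<^sup>2"
    using norm_hmult_le[OF \<phi>, of h] by (simp add: power_mono)
  also have "(norm h)\<^sup>2 \<le> (norm (hker a))\<^sup>2 * (\<Sum>i<N. (norm (c (Suc i)))\<^sup>2)"
    unfolding h_def by (rule Suc.IH)
  finally show ?case
    unfolding split sum.lessThan_Suc_shift[of _ N]
    by (simp add: k_def norm_cscale power_mult_distrib algebra_simps)
qed simp

text \<open>Subordination makes the series of terms f_i \<phi>^i \<open>hker a\<close> converge in
  H2 to (f o \<phi>) \<open>hker a\<close>. Multiplying by \<open>v\<close>, the reciprocal of the
  kernel and bounded by 2, recovers f o \<phi>; hence the bound \<open>2 * B\<close>.\<close>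

lemma comp_op_hardy:
  assumes \<phi>: "\<phi> holomorphic_on disc" "\<And>z. z \<in> disc \<Longrightarrow> \<phi> z \<in> disc" and a: "a \<in> disc" "\<phi> a = 0"
  obtains C where "bounded_linear C" "\<And>f. comp_op \<phi> (hfun f) = hfun (C f)"
proof -
  have mult: "multiplier 1 \<phi>"
    using \<phi> by (auto simp: multiplier_def less_imp_le)
  have pow: "multiplier 1 (\<lambda>z. \<phi> z ^ i)" for i
    using mult by (auto simp: multiplier_def norm_power power_le_one intro!: holomorphic_intros)
  define w where "w i = hmult (\<lambda>z. \<phi> z ^ i) (hker a)" for i
  define B where "B = norm (hker a)"
  define v where "v z = 1 - cnj a * z" for z
  have "norm (v z) \<le> 2" if "z \<in> disc" for z
  proof -
    have "norm (cnj a * z) \<le> 1"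
      using a(1) that by (auto simp: norm_mult intro!: mult_le_one)
    then show ?thesis
      unfolding v_def using norm_triangle_ineq4[of 1 "cnj a * z"] by simp
  qed
  then have v: "multiplier 2 v"
    by (auto simp: multiplier_def v_def[abs_def] intro!: holomorphic_intros)
  have v_nz: "v z \<noteq> 0" if "z \<in> disc" for z
    using one_minus_cnj_mult_bound[of z a] that a by (auto simp: v_def)
  have bound: "norm (\<Sum>i<N. cscale (c i) (w i)) \<le> B * sqrt (\<Sum>i<N. (norm (c i))\<^sup>2)" for N c
  proof (rule power2_le_imp_le)
    show "(norm (\<Sum>i<N. cscale (c i) (w i)))\<^sup>2 \<le> (B * sqrt (\<Sum>i<N. (norm (c i))\<^sup>2))\<^sup>2"
      using kernel_subordination[OF mult a, of c N]
      by (simp add: w_def B_def power_mult_distrib sum_nonneg)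
  qed (simp add: B_def sum_nonneg)
  have "\<exists>g. hfun g = comp_op \<phi> (hfun f) \<and> norm g \<le> 2 * B * norm f" for f
  proof -
    define P where "P N = (\<Sum>i<N. cscale (hcoeff f i) (w i))" for N
    have "summable (\<lambda>i. cscale (hcoeff f i) (w i))"
      unfolding summable_Cauchy
    proof (intro allI impI)
      fix e :: real assume e: "e > 0"
      \<comment> \<open>Chosen so that \<open>B * sqrt e' = e * (B / (B + 1)) < e\<close>, including
        when \<open>B = 0\<close>.\<close>
      define e' where "e' = (e / (B + 1))\<^sup>2"
      have B: "B \<ge> 0" by (simp add: B_def)
      have "e' > 0" using e B by (simp add: e'_def)
      then obtain N where N: "\<And>m n. m \<ge> N \<Longrightarrow> norm (\<Sum>i\<in>{m..<n}. (norm (hcoeff f i))\<^sup>2) < e'"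
        using summable_hcoeff[of f] unfolding summable_Cauchy by metis
      have "norm (\<Sum>i\<in>{m..<n}. cscale (hcoeff f i) (w i)) < e" if m: "m \<ge> N" for m n
      proof -
        \<comment> \<open>Zero padding turns a block from \<open>m\<close> to \<open>n\<close> into
          an initial sum, the form in which \<open>bound\<close> is available.\<close>
        define c where "c i = (if m \<le> i then hcoeff f i else 0)" for i
        have zero: "cscale 0 g = 0" for g
          by (rule hardy_eqI) (simp add: hcoeff_cscale hcoeff_zero)
        have s1: "(\<Sum>i\<in>{m..<n}. cscale (hcoeff f i) (w i)) = (\<Sum>i<n. cscale (c i) (w i))"
          by (rule sum.mono_neutral_cong_left) (auto simp: c_def zero)
        have s2: "(\<Sum>i\<in>{m..<n}. (norm (hcoeff f i))\<^sup>2) = (\<Sum>i<n. (norm (c i))\<^sup>2)"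
          by (rule sum.mono_neutral_cong_left) (auto simp: c_def)
        have "norm (\<Sum>i<n. cscale (c i) (w i)) \<le> B * sqrt (\<Sum>i<n. (norm (c i))\<^sup>2)"
          by (rule bound)
        also have "\<dots> \<le> B * sqrt e'"
          using N[OF m, of n] B unfolding s2 by (intro mult_left_mono) auto
        also have "\<dots> = e * (B / (B + 1))"
          using e B by (simp add: e'_def)
        also have "\<dots> < e"
          using e B by (simp add: field_simps)
        finally show ?thesis unfolding s1 .
      qed
      then show "\<exists>N. \<forall>m\<ge>N. \<forall>n. norm (\<Sum>i\<in>{m..<n}. cscale (hcoeff f i) (w i)) < e" by blast
    qed
    then obtain g where g: "P \<longlonglongrightarrow> g"
      by (auto simp: summable_def sums_def P_def[abs_def])
    have P_le: "norm (P N) \<le> B * norm f" for N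
    proof -
      have "sqrt (\<Sum>i<N. (norm (hcoeff f i))\<^sup>2) \<le> sqrt ((norm f)\<^sup>2)"
        by (intro real_sqrt_le_mono hcoeff_partial_sum_le)
      then have "B * sqrt (\<Sum>i<N. (norm (hcoeff f i))\<^sup>2) \<le> B * norm f"
        by (intro mult_left_mono) (simp_all add: B_def)
      then show ?thesis
        using bound[of "hcoeff f" N] unfolding P_def by linarith
    qed
    have g_le: "norm g \<le> B * norm f"
      by (rule tendsto_upperbound[OF tendsto_norm[OF g]]) (auto simp: P_le)
    have g_eq: "hfun g z = hfun f (\<phi> z) / v z" if z: "z \<in> disc" for z
    proof -
      have hP: "hfun (P N) z = (\<Sum>i<N. hcoeff f i * \<phi> z ^ i) / v z" for N
        unfolding P_def
        by (induction N)
           (simp_all add: hfun_zero hfun_add hfun_cscale w_def hfun_hmult[OF pow z] hfun_hker[OF a(1) z]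
             v_def add_divide_distrib)
      have "(\<lambda>N. (\<Sum>i<N. hcoeff f i * \<phi> z ^ i) / v z) \<longlonglongrightarrow> hfun f (\<phi> z) / v z"
        using hfun_sums[OF \<phi>(2)[OF z], of f] v_nz[OF z] unfolding sums_def by (intro tendsto_divide) auto
      then show ?thesis
        using tendsto_hfun[OF g, of z] LIMSEQ_unique unfolding hP by blast
    qed
    have "hfun (hmult v g) = comp_op \<phi> (hfun f)"
      using v_nz by (auto simp: fun_eq_iff hfun_hmult_toep[OF v] toep_def comp_op_def disc_restrict_def g_eq)
    moreover have "norm (hmult v g) \<le> 2 * B * norm f"
      using norm_hmult_le[OF v, of g] g_le by simp
    ultimately show ?thesis by blast
  qed
  then obtain C where C: "\<And>f. hfun (C f) = comp_op \<phi> (hfun f)" "\<And>f. norm (C f) \<le> 2 * B * norm f"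
    by metis
  have "bounded_linear C"
  proof (rule bounded_linear_intro)
    show "C (f + g) = C f + C g" for f g
      by (rule hardy_fun_eqI) (simp add: C(1) hfun_add comp_op_def disc_restrict_def)
    show "C (r *\<^sub>R f) = r *\<^sub>R C f" for r f
      by (rule hardy_fun_eqI) (simp add: C(1) hfun_scaleR comp_op_def disc_restrict_def)
    show "norm (C f) \<le> norm f * (2 * B)" for f
      using C(2)[of f] by (simp add: mult.commute)
  qed
  with C(1) that show thesis by metis
qed

lemma disc_aut_comp_op:
  assumes "disc_aut \<phi>"
  obtains C where "bounded_linear C" "\<And>f. comp_op \<phi> (hfun f) = hfun (C f)"
proof -
  have hol: "\<phi> holomorphic_on disc" and im: "\<phi> ` disc = disc"
    using assms by (auto simp: disc_aut_def bij_betw_def)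
  have "0 \<in> \<phi> ` disc" using im by simp
  then obtain a where "a \<in> disc" "\<phi> a = 0" by auto
  moreover have "\<phi> z \<in> disc" if "z \<in> disc" for z
    using im that by blast
  ultimately show thesis
    using comp_op_hardy[OF hol] that by metis
qed

text \<open>Translates the abstract \<open>range_norm_bounded\<close> back to H(b), once
  \<open>hb_norm\<close> is identified with the norm of the preimage orthogonal to the
  kernel.\<close>

lemma comp_bounded_on_Hb_if_invariant:
  assumes b: "b \<in> Hinf_ball" and \<phi>: "disc_aut \<phi>"
    and inv: "\<And>f. f \<in> Hb b \<Longrightarrow> comp_op \<phi> f \<in> Hb b"
  shows "comp_bounded_on_Hb b \<phi>"
proof -
  obtain S where S: "bounded_linear S" "\<And>f g. inner (S f) g = inner f (S g)"
    "\<And>c f. S (cscale c f) = cscale c (S f)"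
    and root: "\<And>f. pos_sqrt_op (defect_op b) (hfun f) = hfun (S f)"
    using pos_sqrt_op_defect[OF b] by metis
  obtain C where C: "bounded_linear C" "\<And>f. comp_op \<phi> (hfun f) = hfun (C f)"
    using disc_aut_comp_op[OF \<phi>] by metis
  have H2_range: "H2 = range hfun"
    using hfun by (auto elim: hfun_cases)
  have Hb: "Hb b = range (\<lambda>f. hfun (S f))"
    by (auto simp: Hb_def H2_range image_image root)
  have "\<exists>g. S g = C (S f)" for f
  proof -
    have "comp_op \<phi> (hfun (S f)) \<in> Hb b"
      by (rule inv) (simp add: Hb)
    then show ?thesis
      by (auto simp: Hb C hfun_inject intro: sym)
  qed
  from range_norm_bounded[OF S(1,2) C(1) this] obtain K where
    K: "\<And>f. \<exists>g. S g = C (S f) \<and> (\<forall>k. S k = 0 \<longrightarrow> inner g k = 0) \<and> norm g \<le> K * norm f"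
    by blast
  have hb: "hb_norm b (hfun (S f)) = norm f" if f: "\<And>k. S k = 0 \<Longrightarrow> inner f k = 0" for f
  proof -
    have zero: "hfun g = (\<lambda>_. 0) \<longleftrightarrow> g = 0" for g
      by (simp add: hfun_inject flip: hfun_zero)
    have "(THE h. h \<in> H2 \<and> pos_sqrt_op (defect_op b) h = hfun (S f) \<and>
        (\<forall>k\<in>H2. pos_sqrt_op (defect_op b) k = (\<lambda>_. 0) \<longrightarrow> h2inner h k = 0)) = hfun f"
    proof (rule the_equality, intro conjI ballI impI)
      fix k assume "k \<in> H2" and k: "pos_sqrt_op (defect_op b) k = (\<lambda>_. 0)"
      then obtain k' where k': "k = hfun k'" by (metis hfun_cases)
      \<comment> \<open>The kernel is a complex subspace, so real orthogonality to both elements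
        gives complex orthogonality to \<open>k'\<close>.\<close>
      then have "S k' = 0" "S (cscale \<i> k') = 0"
        using k linear_0[OF bounded_linear.linear[OF bounded_linear_cscale]] by (simp_all add: root zero S(3))
      then show "h2inner (hfun f) k = 0"
        by (simp add: k' complex_eq_iff Re_h2inner Im_h2inner f)
    next
      fix h assume h: "h \<in> H2 \<and> pos_sqrt_op (defect_op b) h = hfun (S f) \<and>
        (\<forall>k\<in>H2. pos_sqrt_op (defect_op b) k = (\<lambda>_. 0) \<longrightarrow> h2inner h k = 0)"
      then obtain g where g: "h = hfun g" by (metis hfun_cases)
      have orth: "inner g k = 0" if "S k = 0" for k
      proof -
        have "h2inner h (hfun k) = 0"
          using h that by (simp add: hfun root zero)
        then show ?thesis by (simp add: g flip: Re_h2inner)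
      qed
      have "S g = S f"
        using h by (simp add: g root hfun_inject)
      then have "g = f"
        by (rule kernel_complement_unique[OF bounded_linear.linear[OF S(1)] _ orth f])
      then show "h = hfun f" by (simp add: g)
    qed (simp_all add: hfun root)
    then show ?thesis by (simp add: hb_norm_def h2norm_hardy)
  qed
  have "hb_norm b (comp_op \<phi> f) \<le> K * hb_norm b f" if "f \<in> Hb b" for f
  proof -
    obtain e where "f = hfun (S e)" using \<open>f \<in> Hb b\<close> by (auto simp: Hb)
    \<comment> \<open>\<open>hb_norm b f\<close> is the norm of this particular preimage, so the
      arbitrary \<open>e\<close> is exchanged before the bound from \<open>K\<close> is
      used.\<close>
    then obtain e' where e: "f = hfun (S e')" "\<And>k. S k = 0 \<Longrightarrow> inner e' k = 0"
      using kernel_complement_representative[OF S(1), of e] by metis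
    obtain g where g: "S g = C (S e')" "\<And>k. S k = 0 \<Longrightarrow> inner g k = 0" "norm g \<le> K * norm e'"
      using K[of e'] by blast
    have "comp_op \<phi> f = hfun (S g)"
      by (simp add: e C g)
    then show ?thesis
      using hb[of e'] hb[of g] e g by simp
  qed
  then show ?thesis
    using inv unfolding comp_bounded_on_Hb_def by blast
qed

section \<open>Moebius maps and their boundary fixed points\<close>

lemma aut_fixed_boundary:
  assumes a: "a \<in> disc" and \<phi>: "\<And>z. z \<in> disc \<Longrightarrow> \<phi> z = l * (z - a) / (1 - cnj a * z)"
    and \<xi>: "norm \<xi> = 1" "aut_fixed \<phi> \<xi>"
  shows "l * (\<xi> - a) / (1 - cnj a * \<xi>) = \<xi>" and "1 - cnj a * \<xi> \<noteq> 0"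
proof -
  show nz: "1 - cnj a * \<xi> \<noteq> 0"
    using one_minus_cnj_mult_bound[of \<xi> a] a \<xi> by auto
  have lim: "(\<phi> \<longlongrightarrow> \<xi>) (at \<xi> within disc)"
    using \<xi> by (simp add: aut_fixed_def)
  have "((\<lambda>z. l * (z - a) / (1 - cnj a * z)) \<longlongrightarrow> l * (\<xi> - a) / (1 - cnj a * \<xi>)) (at \<xi> within disc)"
    by (intro tendsto_intros nz)
  \<comment> \<open>A boundary fixed point is defined through a limit from the disc. The Moebius
    formula is continuous at \<xi>, so uniqueness of limits turns this into an algebraic
    equation.\<close>
  moreover have "\<forall>\<^sub>F z in at \<xi> within disc. l * (z - a) / (1 - cnj a * z) = \<phi> z"
    unfolding eventually_at_filter by (rule always_eventually) (simp add: \<phi>)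
  ultimately have "(\<phi> \<longlongrightarrow> l * (\<xi> - a) / (1 - cnj a * \<xi>)) (at \<xi> within disc)"
    by (rule Lim_transform_eventually)
  moreover have "at \<xi> within disc \<noteq> bot"
  proof -
    have "\<xi> \<in> closure disc" using \<xi> by simp
    then have "\<xi> islimpt disc"
      using \<xi> by (simp add: closure_def)
    then show ?thesis by (simp add: trivial_limit_within)
  qed
  ultimately show "l * (\<xi> - a) / (1 - cnj a * \<xi>) = \<xi>"
    using lim tendsto_unique by blast
qed

lemma kernel_multiplier:
  assumes "a \<in> disc"
  shows "multiplier (norm c / (1 - norm a)) (\<lambda>z. c / (1 - cnj a * z))"
proof -
  have "1 - norm a \<le> norm (1 - cnj a * z)" if "z \<in> disc" for z
    using one_minus_cnj_mult_bound[of z a] that by simp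
  moreover have "0 < 1 - norm a" using assms by simp
  ultimately show ?thesis
    unfolding multiplier_def norm_divide
    by (fastforce intro!: holomorphic_intros divide_left_mono mult_pos_pos)
qed

text \<open>Replacing \<xi> by its own image makes the left side a difference of two Moebius values,
  which carries the factor z - \<xi>.\<close>

lemma moebius_diff_fixed:
  fixes l a \<xi> z :: complex
  assumes "l * (\<xi> - a) / (1 - cnj a * \<xi>) = \<xi>" "1 - cnj a * \<xi> \<noteq> 0" "1 - cnj a * z \<noteq> 0"
  shows "l * (z - a) / (1 - cnj a * z) - \<xi> =
    (z - \<xi>) * (l * (1 - a * cnj a) / (1 - cnj a * \<xi>) / (1 - cnj a * z))"
proof -
  have "l * (z - a) / (1 - cnj a * z) - \<xi> =
      l * (z - a) / (1 - cnj a * z) - l * (\<xi> - a) / (1 - cnj a * \<xi>)"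
    using assms(1) by simp
  also have "\<dots> = (z - \<xi>) * (l * (1 - a * cnj a) / (1 - cnj a * \<xi>) / (1 - cnj a * z))"
    using assms(2,3) by (simp add: divide_simps) (simp add: algebra_simps)
  finally show ?thesis .
qed

text \<open>
  The numerator of \<open>\<phi> z - z\<close> is a quadratic polynomial with the two fixed points as its roots
  and leading coefficient \<open>cnj a\<close>.
\<close>
lemma moebius_diff_id:
  fixes l a \<xi>1 \<xi>2 z :: complex
  assumes fix1: "l * (\<xi>1 - a) / (1 - cnj a * \<xi>1) = \<xi>1" "1 - cnj a * \<xi>1 \<noteq> 0"
    and fix2: "l * (\<xi>2 - a) / (1 - cnj a * \<xi>2) = \<xi>2" "1 - cnj a * \<xi>2 \<noteq> 0"
    and ne: "\<xi>1 \<noteq> \<xi>2" and z: "1 - cnj a * z \<noteq> 0"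
  shows "l * (z - a) / (1 - cnj a * z) = z + (z - \<xi>1) * (z - \<xi>2) * (cnj a / (1 - cnj a * z))"
proof -
  define A where "A = cnj a"
  have e1: "l * (\<xi>1 - a) = \<xi>1 * (1 - A * \<xi>1)" and e2: "l * (\<xi>2 - a) = \<xi>2 * (1 - A * \<xi>2)"
    using fix1 fix2 by (simp_all add: A_def divide_eq_eq)
  \<comment> \<open>Difference of the two fixed-point equations; cancelling \<xi>1 - \<xi>2
    determines \<open>l\<close>.\<close>
  have "(\<xi>1 - \<xi>2) * l = (\<xi>1 - \<xi>2) * (1 - A * (\<xi>1 + \<xi>2))"
    using e1 e2 by algebra
  then have l: "l = 1 - A * (\<xi>1 + \<xi>2)" using ne by simp
  have "l * (z - a) = z * (1 - A * z) + (z - \<xi>1) * (z - \<xi>2) * A"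
    using e1 l by algebra
  then show ?thesis
    using z unfolding A_def by (simp add: divide_simps)
qed

theorem theorem4p5:
  fixes b :: "complex \<Rightarrow> complex"
  assumes "b \<in> Hinf_ball"
  shows "(\<forall>\<phi> \<xi>. parabolic_aut \<phi> \<xi> \<and>
            Hb b = {disc_restrict (\<lambda>z. (z - \<xi>) * h z + c) | h c. h \<in> H2}
            \<longrightarrow> comp_bounded_on_Hb b \<phi>)
       \<and> (\<forall>\<phi> \<xi>1 \<xi>2. hyperbolic_aut \<phi> \<xi>1 \<xi>2 \<and>
            Hb b = {disc_restrict (\<lambda>z. (z - \<xi>1) * (z - \<xi>2) * h z + (c0 + c1 * z)) | h c0 c1. h \<in> H2}
            \<longrightarrow> comp_bounded_on_Hb b \<phi>)"
proof (intro conjI allI impI; elim conjE)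
  fix \<phi> \<xi> assume \<phi>: "parabolic_aut \<phi> \<xi>"
    and Hb: "Hb b = {disc_restrict (\<lambda>z. (z - \<xi>) * h z + c) | h c. h \<in> H2}"
  have aut: "disc_aut \<phi>" and \<xi>: "norm \<xi> = 1" "aut_fixed \<phi> \<xi>"
    using \<phi> by (auto simp: parabolic_aut_def)
  obtain a l where a: "a \<in> disc"
    and moeb: "\<And>z. z \<in> disc \<Longrightarrow> \<phi> z = l * (z - a) / (1 - cnj a * z)"
    using disc_aut_moebius[OF aut] by metis
  note fixed = aut_fixed_boundary[OF a moeb \<xi>]
  define q where "q z = l * (1 - a * cnj a) / (1 - cnj a * \<xi>) / (1 - cnj a * z)" for z
  have \<phi>_disc: "\<phi> z \<in> disc" if "z \<in> disc" for z
    using aut that by (auto simp: disc_aut_def bij_betw_def)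
  have nz: "1 - cnj a * z \<noteq> 0" if "z \<in> disc" for z
    using one_minus_cnj_mult_bound[of z a] that a by auto
  have diff: "\<phi> z - \<xi> = (z - \<xi>) * q z" if "z \<in> disc" for z
    using moebius_diff_fixed[OF fixed nz] that by (simp add: moeb q_def)
  have q: "multiplier (norm (l * (1 - a * cnj a) / (1 - cnj a * \<xi>)) / (1 - norm a)) q"
    unfolding q_def by (rule kernel_multiplier[OF a])
  obtain C where C: "\<And>f. comp_op \<phi> (hfun f) = hfun (C f)"
    using disc_aut_comp_op[OF aut] by metis
  show "comp_bounded_on_Hb b \<phi>"
  proof (rule comp_bounded_on_Hb_if_invariant[OF assms aut])
    fix f assume "f \<in> Hb b"
    then obtain h c where "h \<in> H2" and f: "f = disc_restrict (\<lambda>z. (z - \<xi>) * h z + c)"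
      unfolding Hb by blast
    then obtain g where h: "h = hfun g" by (metis hfun_cases)
    have Cg: "hfun (C g) z = hfun g (\<phi> z)" if "z \<in> disc" for z
      using that by (simp add: C[symmetric] comp_op_def disc_restrict_def)
    \<comment> \<open>The factor \<phi>(z) - \<xi> reproduces z - \<xi> up to the multiplier
      \<open>q\<close>, and the constant is unchanged.\<close>
    have "comp_op \<phi> f = disc_restrict (\<lambda>z. (z - \<xi>) * hfun (hmult q (C g)) z + c)"
    proof
      fix z
      show "comp_op \<phi> f z = disc_restrict (\<lambda>z. (z - \<xi>) * hfun (hmult q (C g)) z + c) z"
        using \<phi>_disc[of z] diff[of z]
        by (cases "z \<in> disc")
           (simp_all add: comp_op_def disc_restrict_def f h hfun_hmult[OF q] Cg)
    qed
    then show "comp_op \<phi> f \<in> Hb b"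
      unfolding Hb using hfun by blast
  qed
next
  fix \<phi> \<xi>1 \<xi>2 assume \<phi>: "hyperbolic_aut \<phi> \<xi>1 \<xi>2"
    and Hb: "Hb b = {disc_restrict (\<lambda>z. (z - \<xi>1) * (z - \<xi>2) * h z + (c0 + c1 * z)) | h c0 c1. h \<in> H2}"
  have aut: "disc_aut \<phi>" and ne: "\<xi>1 \<noteq> \<xi>2"
    and \<xi>1: "norm \<xi>1 = 1" "aut_fixed \<phi> \<xi>1" and \<xi>2: "norm \<xi>2 = 1" "aut_fixed \<phi> \<xi>2"
    using \<phi> by (auto simp: hyperbolic_aut_def)
  obtain a l where a: "a \<in> disc"
    and moeb: "\<And>z. z \<in> disc \<Longrightarrow> \<phi> z = l * (z - a) / (1 - cnj a * z)"
    using disc_aut_moebius[OF aut] by metis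
  note fixed1 = aut_fixed_boundary[OF a moeb \<xi>1]
  note fixed2 = aut_fixed_boundary[OF a moeb \<xi>2]
  define q where "q \<xi> z = l * (1 - a * cnj a) / (1 - cnj a * \<xi>) / (1 - cnj a * z)" for \<xi> z
  have \<phi>_disc: "\<phi> z \<in> disc" if "z \<in> disc" for z
    using aut that by (auto simp: disc_aut_def bij_betw_def)
  have nz: "1 - cnj a * z \<noteq> 0" if "z \<in> disc" for z
    using one_minus_cnj_mult_bound[of z a] that a by auto
  have diff1: "\<phi> z - \<xi>1 = (z - \<xi>1) * q \<xi>1 z" and diff2: "\<phi> z - \<xi>2 = (z - \<xi>2) * q \<xi>2 z"
    if "z \<in> disc" for z
    using moebius_diff_fixed[OF fixed1 nz] moebius_diff_fixed[OF fixed2 nz] that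
    by (simp_all add: moeb q_def)
  have diff_id: "\<phi> z = z + (z - \<xi>1) * (z - \<xi>2) * (cnj a / (1 - cnj a * z))" if "z \<in> disc" for z
    using moebius_diff_id[OF fixed1 fixed2 ne nz] that by (simp add: moeb)
  have q: "multiplier (norm (l * (1 - a * cnj a) / (1 - cnj a * \<xi>)) / (1 - norm a)) (q \<xi>)" for \<xi>
    unfolding q_def by (rule kernel_multiplier[OF a])
  obtain C where C: "\<And>f. comp_op \<phi> (hfun f) = hfun (C f)"
    using disc_aut_comp_op[OF aut] by metis
  show "comp_bounded_on_Hb b \<phi>"
  proof (rule comp_bounded_on_Hb_if_invariant[OF assms aut])
    fix f assume "f \<in> Hb b"
    then obtain h c0 c1 where "h \<in> H2"
      and f: "f = disc_restrict (\<lambda>z. (z - \<xi>1) * (z - \<xi>2) * h z + (c0 + c1 * z))"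
      unfolding Hb by blast
    then obtain g where h: "h = hfun g" by (metis hfun_cases)
    have Cg: "hfun (C g) z = hfun g (\<phi> z)" if "z \<in> disc" for z
      using that by (simp add: C[symmetric] comp_op_def disc_restrict_def)
    \<comment> \<open>The second summand absorbs c1 (\<phi>(z) - z): that difference is (z -
      \<xi>1)(z - \<xi>2) times c1 conj(a) / (1 - conj(a) z), a multiple of the kernel at
      \<open>a\<close> and thus in H2.\<close>
    define k where "k = hmult (q \<xi>1) (hmult (q \<xi>2) (C g)) + cscale (c1 * cnj a) (hker a)"
    have k: "hfun k z = q \<xi>1 z * (q \<xi>2 z * hfun g (\<phi> z)) + c1 * (cnj a / (1 - cnj a * z))" if "z \<in> disc" for z
      using that
      by (simp add: k_def hfun_add hfun_cscale hfun_hmult[OF q] hfun_hker[OF a] Cg)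
    have "comp_op \<phi> f = disc_restrict (\<lambda>z. (z - \<xi>1) * (z - \<xi>2) * hfun k z + (c0 + c1 * z))"
    proof
      fix z
      show "comp_op \<phi> f z = disc_restrict (\<lambda>z. (z - \<xi>1) * (z - \<xi>2) * hfun k z + (c0 + c1 * z)) z"
      proof (cases "z \<in> disc")
        case True
        have "comp_op \<phi> f z = (\<phi> z - \<xi>1) * (\<phi> z - \<xi>2) * hfun g (\<phi> z) + (c0 + c1 * \<phi> z)"
          using True \<phi>_disc[OF True] by (simp add: comp_op_def disc_restrict_def f h)
        also have "\<dots> = ((z - \<xi>1) * q \<xi>1 z) * ((z - \<xi>2) * q \<xi>2 z) * hfun g (\<phi> z) +
            (c0 + c1 * (z + (z - \<xi>1) * (z - \<xi>2) * (cnj a / (1 - cnj a * z))))"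
          by (simp only: diff1[OF True] diff2[OF True] flip: diff_id[OF True])
        also have "\<dots> = (z - \<xi>1) * (z - \<xi>2) * hfun k z + (c0 + c1 * z)"
          unfolding k[OF True] by (simp only: distrib_left mult_ac add_ac)
        finally show ?thesis
          using True by (simp add: disc_restrict_def)
      qed (simp add: comp_op_def disc_restrict_def)
    qed
    then show "comp_op \<phi> f \<in> Hb b"
      unfolding Hb using hfun by blast
  qed
qed

end
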